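(* Let $\mathbb{K}$ be an algebraically closed field of characteristic $0$, $R=\mathbb{K}[\mathbf t,\mathbf x]=\mathbb{K}[t_1,\dots,t_d,x_1,\dots,x_{n-d}]$, and let $I\subseteq R$ be a primary ideal of dimension $d$ for which $\mathbf t$ is a set of independent variables. Let $\{N_1,\dots,N_m\}$ be a minimal set of Noetherian operators for $I$ of the form $N_i=\sum_\alpha f_{\alpha,i}(\mathbf t,\mathbf x)\partial_{\mathbf x}^\alpha$ with $f_{\alpha,i}\in R$ (involving only $\partial_{\mathbf x}$). Let $(\mathbf t_0,\mathbf x_0)\in\mathbb{V}(I)$. If $\mathbf t_0$ is general, then $$\operatorname{span}_{\mathbb{K}}\{N_1(\mathbf t_0,\mathbf x_0),\dots,N_m(\mathbf t_0,\mathbf x_0)\}=D_{\mathfrak m_{(\mathbf t_0,\mathbf x_0)}}[I+(\mathbf t-\mathbf t_0)].$$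
   Context: Independent variables: $t_1,\dots,t_d$ are algebraically independent in $R/I$. A set $N$ of operators in the Weyl algebra $R\langle\partial_{\mathbf t},\partial_{\mathbf x}\rangle$ is a set of Noetherian operators for $I$ if for all $f\in R$: $f\in I\iff D\bullet f\in\sqrt I$ for all $D\in N$; minimal means no proper subset has this property. The specialization is $N_i(\mathbf t_0,\mathbf x_0)=\sum_\alpha f_{\alpha,i}(\mathbf t_0,\mathbf x_0)\partial_{\mathbf x}^\alpha\in\mathbb{K}[\partial_{\mathbf x}]$. For a point $q\in\mathbb{K}^n$ with maximal ideal $\mathfrak m_q$ and an ideal $J\subseteq R$, $D_{\mathfrak m_q}[J]=\{D\in\mathbb{K}[\partial_{\mathbf t},\partial_{\mathbf x}]:(D\bullet f)(q)=0\ \forall f\in J\}$. $(\mathbf t-\mathbf t_0)$ denotes the ideal $(t_1-t_{0,1},\dots,t_d-t_{0,d})$. "General" means for $\mathbf t_0$ outside some proper Zariski-closed subset of $\mathbb{K}^d$. *)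

theory Defs
  imports "HOL-Library.Poly_Mapping" "HOL-Computational_Algebra.Polynomial"
begin

text \<open>Variables are natural numbers. A monomial is a finitely supported multi-index;
  a polynomial maps monomials to coefficients. The ring R = K[t,x] in n variables consists of
  the polynomials all of whose monomials only involve the variables 0..n-1; the first d
  variables 0..d-1 are the t-variables, the variables d..n-1 are the x-variables.\<close>

type_synonym monom = "nat \<Rightarrow>\<^sub>0 nat"
type_synonym 'k mpoly = "monom \<Rightarrow>\<^sub>0 'k"

definition monoms_in :: "nat set \<Rightarrow> monom set" where
  "monoms_in V = {\<alpha>. Poly_Mapping.keys \<alpha> \<subseteq> V}"

definition polys :: "nat \<Rightarrow> ('k::comm_ring_1) mpoly set" where
  "polys n = {p. Poly_Mapping.keys p \<subseteq> monoms_in {..<n}}"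

definition Var :: "nat \<Rightarrow> ('k::comm_ring_1) mpoly" where
  "Var i = Poly_Mapping.single (Poly_Mapping.single i 1) 1"

definition Const :: "'k::comm_ring_1 \<Rightarrow> 'k mpoly" where
  "Const c = Poly_Mapping.single 0 c"

definition eval :: "(nat \<Rightarrow> 'k::comm_ring_1) \<Rightarrow> 'k mpoly \<Rightarrow> 'k" where
  "eval q p = (\<Sum>\<beta>\<in>Poly_Mapping.keys p. Poly_Mapping.lookup p \<beta> * (\<Prod>i\<in>Poly_Mapping.keys \<beta>. q i ^ Poly_Mapping.lookup \<beta> i))"

text \<open>Partial derivative operator \<open>\<partial>^\<alpha>\<close> applied to a polynomial:
  \<open>\<partial>^\<alpha> x^\<beta> = (\<Prod>i. \<beta>_i (\<beta>_i - 1) \<dots> (\<beta>_i - \<alpha>_i + 1)) x^(\<beta>-\<alpha>)\<close>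
  (the coefficient vanishes unless \<alpha> \<le> \<beta>).\<close>
definition dcoeff :: "monom \<Rightarrow> monom \<Rightarrow> nat" where
  "dcoeff \<alpha> \<beta> = (\<Prod>i\<in>Poly_Mapping.keys \<alpha>. \<Prod>j<Poly_Mapping.lookup \<alpha> i. (Poly_Mapping.lookup \<beta> i - j))"

definition dpow :: "monom \<Rightarrow> ('k::comm_ring_1) mpoly \<Rightarrow> 'k mpoly" where
  "dpow \<alpha> p = (\<Sum>\<beta>\<in>Poly_Mapping.keys p. Poly_Mapping.single (\<beta> - \<alpha>) (of_nat (dcoeff \<alpha> \<beta>) * Poly_Mapping.lookup p \<beta>))"

text \<open>Elements of the Weyl algebra, in normal form \<open>\<Sum>\<alpha> f\<alpha> \<partial>^\<alpha>\<close> (coefficients on the left),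
  represented by the finitely supported map \<open>\<alpha> \<mapsto> f\<alpha>\<close>.\<close>
type_synonym 'k weyl = "monom \<Rightarrow>\<^sub>0 'k mpoly"

definition weyl_ops :: "nat \<Rightarrow> ('k::comm_ring_1) weyl set" where
  "weyl_ops n = {D. Poly_Mapping.keys D \<subseteq> monoms_in {..<n} \<and> (\<forall>\<alpha>. Poly_Mapping.lookup D \<alpha> \<in> polys n)}"

definition apply_weyl :: "('k::comm_ring_1) weyl \<Rightarrow> 'k mpoly \<Rightarrow> 'k mpoly" where
  "apply_weyl D f = (\<Sum>\<alpha>\<in>Poly_Mapping.keys D. Poly_Mapping.lookup D \<alpha> * dpow \<alpha> f)"

type_synonym 'k cdiff = "monom \<Rightarrow>\<^sub>0 'k"

definition const_ops :: "nat \<Rightarrow> ('k::comm_ring_1) cdiff set" where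
  "const_ops n = {D. Poly_Mapping.keys D \<subseteq> monoms_in {..<n}}"

definition apply_const :: "('k::comm_ring_1) cdiff \<Rightarrow> 'k mpoly \<Rightarrow> 'k mpoly" where
  "apply_const D f = (\<Sum>\<alpha>\<in>Poly_Mapping.keys D. Const (Poly_Mapping.lookup D \<alpha>) * dpow \<alpha> f)"

definition specialize :: "(nat \<Rightarrow> 'k::comm_ring_1) \<Rightarrow> 'k weyl \<Rightarrow> 'k cdiff" where
  "specialize q N = Poly_Mapping.map (eval q) N"

definition cscale :: "'k::comm_ring_1 \<Rightarrow> 'k cdiff \<Rightarrow> 'k cdiff" where
  "cscale c D = Poly_Mapping.map (\<lambda>v. c * v) D"

definition cspan :: "('k::comm_ring_1) cdiff set \<Rightarrow> 'k cdiff set" where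
  "cspan S = {D. \<exists>T c. finite T \<and> T \<subseteq> S \<and> D = (\<Sum>E\<in>T. cscale (c E) E)}"

definition is_ideal :: "nat \<Rightarrow> ('k::comm_ring_1) mpoly set \<Rightarrow> bool" where
  "is_ideal n I \<longleftrightarrow> I \<subseteq> polys n \<and> 0 \<in> I \<and> (\<forall>f\<in>I. \<forall>g\<in>I. f + g \<in> I)
     \<and> (\<forall>f\<in>I. \<forall>r\<in>polys n. r * f \<in> I)"

definition ideal_gen :: "nat \<Rightarrow> ('k::comm_ring_1) mpoly set \<Rightarrow> 'k mpoly set" where
  "ideal_gen n S = \<Inter>{J. is_ideal n J \<and> S \<subseteq> J}"

definition is_prime_ideal :: "nat \<Rightarrow> ('k::comm_ring_1) mpoly set \<Rightarrow> bool" where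
  "is_prime_ideal n P \<longleftrightarrow> is_ideal n P \<and> 1 \<notin> P
     \<and> (\<forall>f\<in>polys n. \<forall>g\<in>polys n. f * g \<in> P \<longrightarrow> f \<in> P \<or> g \<in> P)"

definition is_primary_ideal :: "nat \<Rightarrow> ('k::comm_ring_1) mpoly set \<Rightarrow> bool" where
  "is_primary_ideal n Q \<longleftrightarrow> is_ideal n Q \<and> 1 \<notin> Q
     \<and> (\<forall>f\<in>polys n. \<forall>g\<in>polys n. f * g \<in> Q \<longrightarrow> f \<in> Q \<or> (\<exists>k. g ^ k \<in> Q))"

definition radical :: "nat \<Rightarrow> ('k::comm_ring_1) mpoly set \<Rightarrow> 'k mpoly set" where
  "radical n I = {f\<in>polys n. \<exists>k. f ^ k \<in> I}"

definition prime_chain :: "nat \<Rightarrow> ('k::comm_ring_1) mpoly set \<Rightarrow> nat \<Rightarrow> (nat \<Rightarrow> 'k mpoly set) \<Rightarrow> bool" where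
  "prime_chain n I l P \<longleftrightarrow> (\<forall>i\<le>l. is_prime_ideal n (P i) \<and> I \<subseteq> P i)
     \<and> (\<forall>i<l. P i \<subset> P (Suc i))"

definition ideal_dim :: "nat \<Rightarrow> ('k::comm_ring_1) mpoly set \<Rightarrow> nat \<Rightarrow> bool" where
  "ideal_dim n I d \<longleftrightarrow> (\<exists>P. prime_chain n I d P) \<and> (\<forall>l P. prime_chain n I l P \<longrightarrow> l \<le> d)"

definition points :: "nat \<Rightarrow> (nat \<Rightarrow> 'k::zero) set" where
  "points n = {q. \<forall>i\<ge>n. q i = 0}"

definition variety :: "nat \<Rightarrow> ('k::comm_ring_1) mpoly set \<Rightarrow> (nat \<Rightarrow> 'k) set" where
  "variety n S = {q\<in>points n. \<forall>f\<in>S. eval q f = 0}"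

definition zariski_closed :: "nat \<Rightarrow> (nat \<Rightarrow> 'k::comm_ring_1) set \<Rightarrow> bool" where
  "zariski_closed n Z \<longleftrightarrow> (\<exists>S\<subseteq>polys n. Z = variety n S)"

definition indep_vars :: "nat \<Rightarrow> ('k::comm_ring_1) mpoly set \<Rightarrow> bool" where
  "indep_vars d I \<longleftrightarrow> (\<forall>f\<in>polys d. f \<in> I \<longrightarrow> f = 0)"

definition noetherian_ops :: "nat \<Rightarrow> ('k::comm_ring_1) mpoly set \<Rightarrow> 'k weyl set \<Rightarrow> bool" where
  "noetherian_ops n I N \<longleftrightarrow> N \<subseteq> weyl_ops n \<and>
     (\<forall>f\<in>polys n. f \<in> I \<longleftrightarrow> (\<forall>D\<in>N. apply_weyl D f \<in> radical n I))"

definition minimal_noetherian_ops :: "nat \<Rightarrow> ('k::comm_ring_1) mpoly set \<Rightarrow> 'k weyl set \<Rightarrow> bool" where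
  "minimal_noetherian_ops n I N \<longleftrightarrow> noetherian_ops n I N \<and> (\<forall>M\<subset>N. \<not> noetherian_ops n I M)"

definition x_only :: "nat \<Rightarrow> nat \<Rightarrow> ('k::comm_ring_1) weyl \<Rightarrow> bool" where
  "x_only d n D \<longleftrightarrow> Poly_Mapping.keys D \<subseteq> monoms_in {d..<n}"

definition punctual_ops :: "nat \<Rightarrow> (nat \<Rightarrow> 'k::comm_ring_1) \<Rightarrow> 'k mpoly set \<Rightarrow> 'k cdiff set" where
  "punctual_ops n q J = {D\<in>const_ops n. \<forall>f\<in>J. eval q (apply_const D f) = 0}"

definition t_part :: "nat \<Rightarrow> (nat \<Rightarrow> 'k::zero) \<Rightarrow> nat \<Rightarrow> 'k" where
  "t_part d q = (\<lambda>i. if i < d then q i else 0)"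

end

theory Submission
  imports Defs
begin

text \<open>
  Write \<open>P\<close> for the radical of \<open>I\<close>. The map sending \<open>f\<close> to the residues of \<open>N\<^sub>1 f, \<dots>, N\<^sub>m f\<close> modulo \<open>P\<close>
  is an injective \<open>K[t]\<close>-linear map from \<open>R/I\<close> to \<open>(R/P)\<^sup>m\<close>. Since \<open>R/P\<close> is finitely generated over a
  localization of \<open>K[t]\<close>, the cokernel is free over a further localization, so the map remains injective
  on the fibre over a general \<open>t\<^sub>0\<close>. In characteristic 0 the fibre of \<open>R/P\<close> over a general \<open>t\<^sub>0\<close> is
  reduced, so an element of it that vanishes at all points of the fibre is 0.
  Let \<open>D\<close> annihilate \<open>I + (t - t\<^sub>0)\<close> at \<open>q\<close>, and let \<open>f\<close> be annihilated at \<open>q\<close> by all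
  \<open>N\<^sub>i(q)\<close>. Multiplying \<open>f\<close> by a polynomial that is 1 to high order at \<open>q\<close> and 0 to high order at the other
  points of the fibre, we may assume that all \<open>N\<^sub>i f\<close> vanish on the whole fibre. Then \<open>f\<close> lies in
  \<open>I + (t - t\<^sub>0)\<close>, so \<open>D f\<close> vanishes at \<open>q\<close>. By duality \<open>D\<close> is a linear combination of the \<open>N\<^sub>i(q)\<close>.
\<close>

section \<open>Polynomials and differential operators\<close>

text \<open>The dimension hypothesis speaks of chains of primes, while the argument needs two facts
  about \<open>R/P\<close> over \<open>K[t]\<close>: each remaining variable is algebraic, and each
  nonzero residue divides the residue of a nonzero element of \<open>K[t]\<close>. The link is a
  chain of \<open>card V\<close> strict inclusions of primes, built from any set \<open>V\<close> of
  variables independent modulo a prime; failure of either fact would give too long a chain.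
  Reducedness of the general fibre is made explicit: a relation of least degree for a variable over
  \<open>K[t]\<close> has its derivative outside \<open>P\<close>, and where a suitable multiple of
  that derivative in \<open>K[t]\<close> does not vanish, the variable satisfies an equation with
  simple roots on the fibre. Such equations for all coordinates make the Nullstellensatz on the
  fibre elementary and the fibre finite, so that its points can be separated. Quotients and
  localizations appear only as congruences modulo an ideal after multiplication by a power of one
  element of \<open>K[t]\<close>.\<close>

lemma poly_mapping_sum_single: "(\<Sum>k\<in>Poly_Mapping.keys p. Poly_Mapping.single k (Poly_Mapping.lookup p k)) = p"
  by (rule poly_mapping_eqI)
    (auto simp: lookup_sum lookup_single when_def sum.delta in_keys_iff)

definition monom_eval :: "(nat \<Rightarrow> 'k::comm_ring_1) \<Rightarrow> monom \<Rightarrow> 'k" where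
  "monom_eval q \<beta> = (\<Prod>i\<in>Poly_Mapping.keys \<beta>. q i ^ Poly_Mapping.lookup \<beta> i)"

lemma monom_eval_superset:
  assumes "finite A" "Poly_Mapping.keys \<beta> \<subseteq> A"
  shows "monom_eval q \<beta> = (\<Prod>i\<in>A. q i ^ Poly_Mapping.lookup \<beta> i)"
  unfolding monom_eval_def by (rule prod.mono_neutral_left) (use assms in \<open>auto simp: in_keys_iff\<close>)

lemma monom_eval_add: "monom_eval q (\<alpha> + \<beta>) = monom_eval q \<alpha> * monom_eval q \<beta>"
proof -
  let ?A = "Poly_Mapping.keys \<alpha> \<union> Poly_Mapping.keys \<beta>"
  show ?thesis
    using keys_add[of \<alpha> \<beta>]
    by (simp add: monom_eval_superset[of ?A] lookup_add power_add prod.distrib)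
qed

lemma eval_superset:
  assumes "finite A" "Poly_Mapping.keys p \<subseteq> A"
  shows "eval q p = (\<Sum>\<beta>\<in>A. Poly_Mapping.lookup p \<beta> * monom_eval q \<beta>)"
  unfolding eval_def monom_eval_def
  by (rule sum.mono_neutral_left) (use assms in \<open>auto simp: in_keys_iff\<close>)

lemma eval_zero [simp]: "eval q 0 = 0"
  by (simp add: eval_def)

lemma eval_add [simp]: "eval q (f + g) = eval q f + eval q g"
proof -
  let ?A = "Poly_Mapping.keys f \<union> Poly_Mapping.keys g"
  show ?thesis
    using keys_add[of f g]
    by (simp add: eval_superset[of ?A] lookup_add distrib_right sum.distrib)
qed

lemma eval_single: "eval q (Poly_Mapping.single \<beta> c) = c * monom_eval q \<beta>"
  by (simp add: eval_def monom_eval_def)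

lemma eval_sum [simp]: "eval q (\<Sum>x\<in>A. f x) = (\<Sum>x\<in>A. eval q (f x))"
  by (induction A rule: infinite_finite_induct) auto

lemma eval_mult [simp]: "eval q (f * g) = eval q f * eval q g"
proof -
  have s: "eval q (Poly_Mapping.single a c * Poly_Mapping.single b d) =
      eval q (Poly_Mapping.single a c) * eval q (Poly_Mapping.single b d)" for a b c d
    by (simp add: mult_single eval_single monom_eval_add algebra_simps)
  have "eval q ((\<Sum>k\<in>Poly_Mapping.keys f. Poly_Mapping.single k (Poly_Mapping.lookup f k)) *
      (\<Sum>k\<in>Poly_Mapping.keys g. Poly_Mapping.single k (Poly_Mapping.lookup g k))) =
    eval q (\<Sum>k\<in>Poly_Mapping.keys f. Poly_Mapping.single k (Poly_Mapping.lookup f k)) *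
    eval q (\<Sum>k\<in>Poly_Mapping.keys g. Poly_Mapping.single k (Poly_Mapping.lookup g k))"
    unfolding sum_product eval_sum by (simp add: s)
  then show ?thesis by (simp only: poly_mapping_sum_single)
qed

lemma eval_Const [simp]: "eval q (Const c) = c"
  by (simp add: Const_def eval_single monom_eval_def)

lemma Const_1 [simp]: "Const 1 = 1"
  by (simp add: Const_def)

lemma Const_0 [simp]: "Const 0 = 0"
  by (simp add: Const_def)

lemma Const_add: "Const (a + b) = Const a + Const b"
  by (simp add: Const_def single_add)

lemma Const_diff: "Const (a - b) = Const a - Const b"
  by (simp add: Const_def single_diff)

lemma Const_uminus: "Const (- b) = - Const b"
  by (simp add: Const_def single_uminus)

lemma Const_mult: "Const (a * b) = Const a * Const b"
  by (simp add: Const_def mult_single)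

lemma Const_of_nat: "Const (of_nat m) = of_nat m"
  by (simp add: Const_def)

lemma eval_1 [simp]: "eval q 1 = 1"
  by (metis Const_1 eval_Const)

lemma eval_of_nat [simp]: "eval q (of_nat m) = of_nat m"
  by (metis Const_of_nat eval_Const)

lemma eval_Var [simp]: "eval q (Var i) = q i"
  by (simp add: Var_def eval_single monom_eval_def)

lemma eval_uminus [simp]: "eval q (- f) = - eval q f"
  by (metis eval_add eval_zero add.right_inverse add_eq_0_iff)

lemma eval_diff [simp]: "eval q (f - g) = eval q f - eval q g"
  using eval_add[of q f "- g"] by simp

lemma eval_power [simp]: "eval q (f ^ k) = eval q f ^ k"
  by (induction k) auto

lemma eval_prod [simp]: "eval q (\<Prod>x\<in>A. f x) = (\<Prod>x\<in>A. eval q (f x))"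
  by (induction A rule: infinite_finite_induct) auto

section \<open>Polynomials in a given set of variables\<close>

definition polys_in :: "nat set \<Rightarrow> ('k::comm_ring_1) mpoly set" where
  "polys_in V = {p. Poly_Mapping.keys p \<subseteq> monoms_in V}"

lemma polys_eq: "polys n = polys_in {..<n}"
  by (simp add: polys_def polys_in_def)

lemma polys_in_mono: "V \<subseteq> W \<Longrightarrow> polys_in V \<subseteq> polys_in W"
  by (auto simp: polys_in_def monoms_in_def)

lemma monoms_in_add: "\<alpha> \<in> monoms_in V \<Longrightarrow> \<beta> \<in> monoms_in V \<Longrightarrow> \<alpha> + \<beta> \<in> monoms_in V"
  using keys_add[of \<alpha> \<beta>] by (auto simp: monoms_in_def)

lemma polys_in_0 [simp]: "0 \<in> polys_in V"
  by (simp add: polys_in_def)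

lemma polys_in_Const [simp]: "Const c \<in> polys_in V"
  by (simp add: polys_in_def Const_def monoms_in_def)

lemma polys_in_1 [simp]: "1 \<in> polys_in V"
  using polys_in_Const[of 1 V] by simp

lemma polys_in_of_nat [simp]: "of_nat m \<in> polys_in V"
  using polys_in_Const[of "of_nat m" V] by (simp add: Const_of_nat)

lemma polys_in_Var [simp]: "i \<in> V \<Longrightarrow> Var i \<in> polys_in V"
  by (simp add: polys_in_def Var_def monoms_in_def)

lemma polys_in_add [simp]: "f \<in> polys_in V \<Longrightarrow> g \<in> polys_in V \<Longrightarrow> f + g \<in> polys_in V"
  using keys_add[of f g] by (auto simp: polys_in_def)

lemma polys_in_uminus [simp]: "f \<in> polys_in V \<Longrightarrow> - f \<in> polys_in V"
  by (auto simp: polys_in_def in_keys_iff subset_iff)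

lemma polys_in_diff [simp]: "f \<in> polys_in V \<Longrightarrow> g \<in> polys_in V \<Longrightarrow> f - g \<in> polys_in V"
  using polys_in_add[of f V "- g"] by simp

lemma polys_in_mult [simp]: "f \<in> polys_in V \<Longrightarrow> g \<in> polys_in V \<Longrightarrow> f * g \<in> polys_in V"
  using keys_mult[of f g] monoms_in_add by (fastforce simp: polys_in_def)

lemma polys_in_power [simp]: "f \<in> polys_in V \<Longrightarrow> f ^ k \<in> polys_in V"
  by (induction k) auto

lemma polys_in_sum [simp]: "(\<And>x. x \<in> A \<Longrightarrow> f x \<in> polys_in V) \<Longrightarrow> sum f A \<in> polys_in V"
  by (induction A rule: infinite_finite_induct) auto

lemma polys_in_prod [simp]: "(\<And>x. x \<in> A \<Longrightarrow> f x \<in> polys_in V) \<Longrightarrow> prod f A \<in> polys_in V"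
  by (induction A rule: infinite_finite_induct) auto

lemma polys_in_single: "\<beta> \<in> monoms_in V \<Longrightarrow> Poly_Mapping.single \<beta> c \<in> polys_in V"
  by (simp add: polys_in_def)

lemma monom_induct [consumes 1, case_names zero add]:
  assumes "\<beta> \<in> monoms_in V" "P 0"
    and "\<And>\<beta> i. \<beta> \<in> monoms_in V \<Longrightarrow> i \<in> V \<Longrightarrow> P \<beta> \<Longrightarrow> P (\<beta> + Poly_Mapping.single i 1)"
  shows "P \<beta>"
  using assms(1)
proof (induction "\<Sum>i\<in>Poly_Mapping.keys \<beta>. Poly_Mapping.lookup \<beta> i" arbitrary: \<beta> rule: less_induct)
  case (less \<beta>)
  show ?case
  proof (cases "Poly_Mapping.keys \<beta> = {}")
    case True
    then have "\<beta> = 0" by (intro poly_mapping_eqI) (auto simp: in_keys_iff)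
    then show ?thesis using assms by simp
  next
    case False
    then obtain i where i: "i \<in> Poly_Mapping.keys \<beta>" by blast
    define \<gamma> where "\<gamma> = \<beta> - Poly_Mapping.single i 1"
    have eq: "\<beta> = \<gamma> + Poly_Mapping.single i 1"
      using i by (intro poly_mapping_eqI)
        (auto simp: \<gamma>_def lookup_add lookup_minus lookup_single when_def in_keys_iff)
    have sub: "Poly_Mapping.keys \<gamma> \<subseteq> Poly_Mapping.keys \<beta>"
      by (auto simp: \<gamma>_def lookup_minus in_keys_iff)
    have "(\<Sum>j\<in>Poly_Mapping.keys \<gamma>. Poly_Mapping.lookup \<gamma> j) = (\<Sum>j\<in>Poly_Mapping.keys \<beta>. Poly_Mapping.lookup \<gamma> j)"
      by (rule sum.mono_neutral_left) (use sub in \<open>auto simp: in_keys_iff\<close>)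
    also have "\<dots> < (\<Sum>j\<in>Poly_Mapping.keys \<beta>. Poly_Mapping.lookup \<beta> j)"
      by (rule sum_strict_mono_ex1)
        (use i in \<open>auto simp: \<gamma>_def lookup_minus lookup_single in_keys_iff intro!: bexI[of _ i]\<close>)
    finally have "P \<gamma>" using less sub by (auto simp: monoms_in_def)
    moreover have "\<gamma> \<in> monoms_in V" "i \<in> V"
      using sub less.prems i by (auto simp: monoms_in_def)
    ultimately show ?thesis using assms(3) eq by metis
  qed
qed

lemma Var_mult_single: "Var i * Poly_Mapping.single \<beta> c = Poly_Mapping.single (\<beta> + Poly_Mapping.single i 1) c"
  by (simp add: Var_def mult_single add.commute)

text \<open>Products occur only with a variable, which is the case that the product rule
  \<open>dpow_Var_mult\<close> covers.\<close>

lemma polys_in_induct [consumes 1, case_names const add var]: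
  assumes "f \<in> polys_in V" "\<And>c. P (Const c)"
    and "\<And>f g. f \<in> polys_in V \<Longrightarrow> g \<in> polys_in V \<Longrightarrow> P f \<Longrightarrow> P g \<Longrightarrow> P (f + g)"
    and "\<And>f i. f \<in> polys_in V \<Longrightarrow> i \<in> V \<Longrightarrow> P f \<Longrightarrow> P (Var i * f)"
  shows "P f"
proof -
  have single: "P (Poly_Mapping.single \<beta> c)" if "\<beta> \<in> monoms_in V" for \<beta> c
    using that
  proof (induction rule: monom_induct)
    case zero
    then show ?case using assms(2)[of c] by (simp add: Const_def)
  next
    case (add \<beta> i)
    then show ?case using assms(4)[of "Poly_Mapping.single \<beta> c" i]
      by (simp add: Var_mult_single polys_in_single)
  qed
  have "P (\<Sum>k\<in>K. Poly_Mapping.single k (Poly_Mapping.lookup f k))" if "finite K" "K \<subseteq> monoms_in V" for K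
    using that
  proof (induction rule: finite_induct)
    case empty
    then show ?case using assms(2)[of 0] by simp
  next
    case (insert k K)
    then show ?case using assms(3) single by (simp add: polys_in_single subset_iff)
  qed
  from this[of "Poly_Mapping.keys f"] show ?thesis
    using assms(1) by (simp add: poly_mapping_sum_single polys_in_def)
qed

lemma polys_in_UNIV: "f \<in> polys_in UNIV"
  by (simp add: polys_in_def monoms_in_def)

section \<open>Partial derivatives and the product rule\<close>

lemma dcoeff_superset:
  assumes "finite A" "Poly_Mapping.keys \<alpha> \<subseteq> A"
  shows "dcoeff \<alpha> \<beta> = (\<Prod>i\<in>A. \<Prod>j<Poly_Mapping.lookup \<alpha> i. (Poly_Mapping.lookup \<beta> i - j))"
  unfolding dcoeff_def by (rule prod.mono_neutral_left) (use assms in \<open>auto simp: in_keys_iff\<close>)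

text \<open>Pascal's rule for falling factorials. Truncated subtraction does no harm: for
  \<open>a > b\<close> the factor at \<open>k = b\<close> is 0 and both sides vanish.\<close>

lemma prod_diff_Suc:
  "(\<Prod>k<Suc a. Suc b - k) = (\<Prod>k<Suc a. b - k) + Suc a * (\<Prod>k<a. b - k)"
proof (cases "a \<le> b")
  case True
  have "(\<Prod>k<Suc a. b - k) + Suc a * (\<Prod>k<a. b - k) = ((b - a) + Suc a) * (\<Prod>k<a. b - k)"
    by (simp only: prod.lessThan_Suc distrib_right) (simp only: mult.commute)
  also have "(b - a) + Suc a = Suc b" using True by simp
  also have "Suc b * (\<Prod>k<a. b - k) = (\<Prod>k<Suc a. Suc b - k)"
    by (subst prod.lessThan_Suc_shift) simp
  finally show ?thesis by simp
next
  case False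
  then have "(\<Prod>k<a. b - k) = 0" by (auto intro!: bexI[of _ b])
  then show ?thesis
    by (subst prod.lessThan_Suc_shift)
      (simp only: prod.lessThan_Suc diff_Suc_Suc mult_0 mult_0_right add_0_right)
qed

text \<open>The product rule for a variable times a monomial, read off on coefficients: only the
  factor at \<open>j\<close> changes, and there it is \<open>prod_diff_Suc\<close>.\<close>

lemma dcoeff_add_single:
  "dcoeff \<alpha> (\<beta> + Poly_Mapping.single j 1) =
    dcoeff \<alpha> \<beta> + Poly_Mapping.lookup \<alpha> j * dcoeff (\<alpha> - Poly_Mapping.single j 1) \<beta>"
proof (cases "Poly_Mapping.lookup \<alpha> j")
  case 0
  then show ?thesis unfolding dcoeff_def
    by (simp, intro prod.cong refl) (auto simp: lookup_add lookup_single when_def in_keys_iff)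
next
  case (Suc a)
  let ?A = "Poly_Mapping.keys \<alpha>"
  have sub: "Poly_Mapping.keys (\<alpha> - Poly_Mapping.single j 1) \<subseteq> ?A"
    by (auto simp: lookup_minus in_keys_iff)
  have j: "j \<in> ?A" using Suc by (simp add: in_keys_iff)
  have 1: "(\<Prod>i\<in>?A - {j}. \<Prod>k<Poly_Mapping.lookup \<alpha> i. Poly_Mapping.lookup (\<beta> + Poly_Mapping.single j 1) i - k)
     = (\<Prod>i\<in>?A - {j}. \<Prod>k<Poly_Mapping.lookup \<alpha> i. Poly_Mapping.lookup \<beta> i - k)"
    by (intro prod.cong refl) (auto simp: lookup_add lookup_single when_def)
  have 2: "(\<Prod>i\<in>?A - {j}. \<Prod>k<Poly_Mapping.lookup (\<alpha> - Poly_Mapping.single j 1) i. Poly_Mapping.lookup \<beta> i - k)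
     = (\<Prod>i\<in>?A - {j}. \<Prod>k<Poly_Mapping.lookup \<alpha> i. Poly_Mapping.lookup \<beta> i - k)"
    by (intro prod.cong refl) (auto simp: lookup_minus lookup_single when_def)
  show ?thesis
    unfolding dcoeff_superset[OF finite_keys sub] dcoeff_superset[OF finite_keys subset_refl, of \<alpha>]
    using Suc prod_diff_Suc[where b="Poly_Mapping.lookup \<beta> j" and a=a]
    by (simp add: prod.remove[OF finite_keys j] 1 2 del: prod.lessThan_Suc)
      (simp add: lookup_minus lookup_add lookup_single algebra_simps del: prod.lessThan_Suc)
qed

lemma dpow_superset:
  assumes "finite A" "Poly_Mapping.keys p \<subseteq> A"
  shows "dpow \<alpha> p = (\<Sum>\<beta>\<in>A. Poly_Mapping.single (\<beta> - \<alpha>) (of_nat (dcoeff \<alpha> \<beta>) * Poly_Mapping.lookup p \<beta>))"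
  unfolding dpow_def
  by (rule sum.mono_neutral_left) (use assms in \<open>auto simp: in_keys_iff\<close>)

lemma dpow_add: "dpow \<alpha> (f + g) = dpow \<alpha> f + dpow \<alpha> g"
proof -
  let ?A = "Poly_Mapping.keys f \<union> Poly_Mapping.keys g"
  show ?thesis
    using keys_add[of f g]
    by (simp add: dpow_superset[of ?A] lookup_add distrib_left single_add sum.distrib)
qed

lemma dpow_single: "dpow \<alpha> (Poly_Mapping.single \<beta> c) = Poly_Mapping.single (\<beta> - \<alpha>) (of_nat (dcoeff \<alpha> \<beta>) * c)"
  by (simp add: dpow_def)

lemma dpow_0 [simp]: "dpow \<alpha> 0 = 0"
  by (simp add: dpow_def)

lemma dpow_sum: "dpow \<alpha> (\<Sum>x\<in>A. f x) = (\<Sum>x\<in>A. dpow \<alpha> (f x))"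
  by (induction A rule: infinite_finite_induct) (auto simp: dpow_add)

lemma dpow_Const_mult: "dpow \<alpha> (Const c * f) = Const c * dpow \<alpha> f"
proof -
  have "dpow \<alpha> (Const c * (\<Sum>k\<in>Poly_Mapping.keys f. Poly_Mapping.single k (Poly_Mapping.lookup f k)))
     = Const c * dpow \<alpha> (\<Sum>k\<in>Poly_Mapping.keys f. Poly_Mapping.single k (Poly_Mapping.lookup f k))"
    unfolding dpow_sum sum_distrib_left
    by (simp add: Const_def mult_single dpow_single ac_simps)
  then show ?thesis by (simp add: poly_mapping_sum_single)
qed

lemma dpow_uminus: "dpow \<alpha> (- f) = - dpow \<alpha> f"
  using dpow_add[of \<alpha> f "- f"] by (simp add: eq_neg_iff_add_eq_0 add.commute)

lemma dpow_diff: "dpow \<alpha> (f - g) = dpow \<alpha> f - dpow \<alpha> g"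
  using dpow_add[of \<alpha> f "- g"] by (simp add: dpow_uminus)

text \<open>The commutation relation of the Weyl algebra. By linearity it suffices to treat
  monomials, where the coefficients agree by \<open>dcoeff_add_single\<close>.\<close>

lemma dpow_Var_mult:
  "dpow \<alpha> (Var j * f) =
    Var j * dpow \<alpha> f + of_nat (Poly_Mapping.lookup \<alpha> j) * dpow (\<alpha> - Poly_Mapping.single j 1) f"
proof -
  let ?e = "Poly_Mapping.single j (1::nat)"
  have s: "dpow \<alpha> (Var j * Poly_Mapping.single \<beta> c) = Var j * dpow \<alpha> (Poly_Mapping.single \<beta> c) +
      of_nat (Poly_Mapping.lookup \<alpha> j) * dpow (\<alpha> - ?e) (Poly_Mapping.single \<beta> c)" for \<beta> and c :: 'a
  proof -
    \<comment> \<open>With truncated subtraction the two exponents agree only if \<alpha> is at most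
      \<beta> at \<open>j\<close>; otherwise the coefficient is 0. The same care is needed in the
      next fact, where the exceptional case is \<alpha> being 0 at \<open>j\<close>.\<close>
    have 1: "Poly_Mapping.single (\<beta> + ?e - \<alpha>) (of_nat (dcoeff \<alpha> \<beta>) * c) =
        Poly_Mapping.single (\<beta> - \<alpha> + ?e) (of_nat (dcoeff \<alpha> \<beta>) * c)"
    proof (cases "Poly_Mapping.lookup \<alpha> j \<le> Poly_Mapping.lookup \<beta> j")
      case True
      then have "\<beta> + ?e - \<alpha> = \<beta> - \<alpha> + ?e"
        by (intro poly_mapping_eqI) (auto simp: lookup_add lookup_minus lookup_single when_def)
      then show ?thesis by simp
    next
      case False
      then have "j \<in> Poly_Mapping.keys \<alpha>" by (auto simp: in_keys_iff)
      moreover have "(\<Prod>k<Poly_Mapping.lookup \<alpha> j. Poly_Mapping.lookup \<beta> j - k) = 0"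
        using False by (intro prod_zero bexI[of _ "Poly_Mapping.lookup \<beta> j"]) auto
      ultimately have "dcoeff \<alpha> \<beta> = 0" unfolding dcoeff_def by (intro prod_zero) auto
      then show ?thesis by simp
    qed
    have 2: "Poly_Mapping.single (\<beta> + ?e - \<alpha>) (of_nat (Poly_Mapping.lookup \<alpha> j) * (of_nat (dcoeff (\<alpha> - ?e) \<beta>) * c)) =
       Poly_Mapping.single (\<beta> - (\<alpha> - ?e)) (of_nat (Poly_Mapping.lookup \<alpha> j) * (of_nat (dcoeff (\<alpha> - ?e) \<beta>) * c))"
    proof (cases "Poly_Mapping.lookup \<alpha> j = 0")
      case False
      then have "\<beta> + ?e - \<alpha> = \<beta> - (\<alpha> - ?e)"
        by (intro poly_mapping_eqI) (auto simp: lookup_add lookup_minus lookup_single when_def)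
      then show ?thesis by simp
    qed simp
    have 3: "of_nat m * Poly_Mapping.single k d = Poly_Mapping.single k (of_nat m * d)"
      for m k and d :: 'a
      by (metis mult_single add_0 single_of_nat)
    show ?thesis
      unfolding Var_mult_single dpow_single 3 1[symmetric] 2[symmetric] dcoeff_add_single
      by (simp add: single_add[symmetric] algebra_simps)
  qed
  have "dpow \<alpha> (Var j * (\<Sum>k\<in>Poly_Mapping.keys f. Poly_Mapping.single k (Poly_Mapping.lookup f k))) =
      Var j * dpow \<alpha> (\<Sum>k\<in>Poly_Mapping.keys f. Poly_Mapping.single k (Poly_Mapping.lookup f k)) +
      of_nat (Poly_Mapping.lookup \<alpha> j) *
        dpow (\<alpha> - ?e) (\<Sum>k\<in>Poly_Mapping.keys f. Poly_Mapping.single k (Poly_Mapping.lookup f k))"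
    unfolding dpow_sum sum_distrib_left s by (simp add: sum.distrib sum_distrib_left)
  then show ?thesis by (simp add: poly_mapping_sum_single)
qed

lemma dpow_closed: "f \<in> polys_in V \<Longrightarrow> dpow \<alpha> f \<in> polys_in V"
  unfolding dpow_def by (rule polys_in_sum, rule polys_in_single)
    (force simp: monoms_in_def polys_in_def in_keys_iff lookup_minus)

section \<open>Order of vanishing at a point\<close>

definition mdeg :: "monom \<Rightarrow> nat" where
  "mdeg \<alpha> = (\<Sum>i\<in>Poly_Mapping.keys \<alpha>. Poly_Mapping.lookup \<alpha> i)"

lemma mdeg_diff_single:
  assumes "Poly_Mapping.lookup \<alpha> j \<noteq> 0"
  shows "mdeg (\<alpha> - Poly_Mapping.single j 1) < mdeg \<alpha>"
proof -
  let ?\<gamma> = "\<alpha> - Poly_Mapping.single j 1"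
  have "(\<Sum>i\<in>Poly_Mapping.keys ?\<gamma>. Poly_Mapping.lookup ?\<gamma> i) = (\<Sum>i\<in>Poly_Mapping.keys \<alpha>. Poly_Mapping.lookup ?\<gamma> i)"
    by (rule sum.mono_neutral_left) (auto simp: in_keys_iff lookup_minus)
  also have "\<dots> < (\<Sum>i\<in>Poly_Mapping.keys \<alpha>. Poly_Mapping.lookup \<alpha> i)"
    by (rule sum_strict_mono_ex1)
      (use assms in \<open>auto simp: lookup_minus lookup_single in_keys_iff intro!: bexI[of _ j]\<close>)
  finally show ?thesis by (simp add: mdeg_def)
qed

text \<open>Over a field of characteristic 0 this is the \<open>L\<close>-th power of the maximal
  ideal of \<open>q\<close>, by Taylor expansion.\<close>

definition vanish :: "(nat \<Rightarrow> 'k::comm_ring_1) \<Rightarrow> nat \<Rightarrow> 'k mpoly set" where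
  "vanish q L = {f. \<forall>\<alpha>. mdeg \<alpha> < L \<longrightarrow> eval q (dpow \<alpha> f) = 0}"

lemma vanish_add: "f \<in> vanish q L \<Longrightarrow> g \<in> vanish q L \<Longrightarrow> f + g \<in> vanish q L"
  by (simp add: vanish_def dpow_add)

lemma vanish_Const: "f \<in> vanish q L \<Longrightarrow> Const c * f \<in> vanish q L"
  by (simp add: vanish_def dpow_Const_mult)

lemma vanish_Var: "f \<in> vanish q L \<Longrightarrow> Var i * f \<in> vanish q L"
  unfolding vanish_def
proof (intro CollectI allI impI)
  fix \<alpha> assume f: "f \<in> {f. \<forall>\<alpha>. mdeg \<alpha> < L \<longrightarrow> eval q (dpow \<alpha> f) = 0}" and a: "mdeg \<alpha> < L"
  show "eval q (dpow \<alpha> (Var i * f)) = 0"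
    using f a mdeg_diff_single[of \<alpha> i]
    by (cases "Poly_Mapping.lookup \<alpha> i = 0") (auto simp: dpow_Var_mult)
qed

text \<open>In the product rule one term keeps the factor \<open>Var i - Const (q i)\<close>, which
  is 0 at \<open>q\<close>; the other has a derivative of one order less.\<close>

lemma vanish_Var_diff:
  assumes "f \<in> vanish q L"
  shows "(Var i - Const (q i)) * f \<in> vanish q (Suc L)"
  unfolding vanish_def
proof (intro CollectI allI impI)
  fix \<alpha> assume a: "mdeg \<alpha> < Suc L"
  have "(of_nat (Poly_Mapping.lookup \<alpha> i) :: 'a) * eval q (dpow (\<alpha> - Poly_Mapping.single i 1) f) = 0"
  proof (cases "Poly_Mapping.lookup \<alpha> i = 0")
    case False
    then have "mdeg (\<alpha> - Poly_Mapping.single i 1) < L"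
      using mdeg_diff_single[of \<alpha> i] a by simp
    then show ?thesis using assms by (simp add: vanish_def)
  qed simp
  then show "eval q (dpow \<alpha> ((Var i - Const (q i)) * f)) = 0"
    by (simp add: left_diff_distrib dpow_diff dpow_Var_mult dpow_Const_mult)
qed

text \<open>Induction on \<open>w\<close> through
  \<open>x w - x(q) w(q) = x (w - w(q)) + w(q) (x - x(q))\<close> for a variable \<open>x\<close>:
  all the gain in order comes from linear factors.\<close>

lemma vanish_diff_eval:
  assumes "f \<in> vanish q L"
  shows "(w - Const (eval q w)) * f \<in> vanish q (Suc L)"
proof (induction w rule: polys_in_induct[OF polys_in_UNIV, case_names const add var])
  case (const c)
  then show ?case using assms by (simp add: vanish_def)
next
  case (add w v)
  then show ?case
    using vanish_add[OF add(3,4)] by (simp add: Const_add algebra_simps)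
next
  case (var w i)
  have "Var i * ((w - Const (eval q w)) * f) + Const (eval q w) * ((Var i - Const (q i)) * f)
      \<in> vanish q (Suc L)"
    by (intro vanish_add vanish_Var vanish_Const vanish_Var_diff var assms)
  then show ?case by (simp add: Const_mult algebra_simps)
qed

lemma vanish_power:
  assumes "eval q w = 0"
  shows "w ^ L * f \<in> vanish q L"
proof (induction L)
  case 0
  then show ?case by (simp add: vanish_def)
next
  case (Suc L)
  then show ?case using vanish_diff_eval[OF Suc, of w] assms by (simp add: mult.assoc)
qed

section \<open>Operators as linear functionals at a point\<close>

definition pairing :: "(nat \<Rightarrow> 'k::comm_ring_1) \<Rightarrow> 'k cdiff \<Rightarrow> 'k mpoly \<Rightarrow> 'k" where
  "pairing q D f = (\<Sum>\<alpha>\<in>Poly_Mapping.keys D. Poly_Mapping.lookup D \<alpha> * eval q (dpow \<alpha> f))"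

lemma pairing_superset:
  assumes "finite A" "Poly_Mapping.keys D \<subseteq> A"
  shows "pairing q D f = (\<Sum>\<alpha>\<in>A. Poly_Mapping.lookup D \<alpha> * eval q (dpow \<alpha> f))"
  unfolding pairing_def by (rule sum.mono_neutral_left) (use assms in \<open>auto simp: in_keys_iff\<close>)

lemma pairing_add_right: "pairing q D (f + g) = pairing q D f + pairing q D g"
  by (simp add: pairing_def dpow_add distrib_left sum.distrib)

lemma pairing_Const_right: "pairing q D (Const c * f) = c * pairing q D f"
  by (simp add: pairing_def dpow_Const_mult sum_distrib_left mult.left_commute)

lemma pairing_diff_right: "pairing q D (f - g) = pairing q D f - pairing q D g"
  by (simp add: pairing_def dpow_diff right_diff_distrib sum_subtractf)

lemma pairing_0_left [simp]: "pairing q 0 f = 0"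
  by (simp add: pairing_def)

lemma pairing_add_left: "pairing q (D + E) f = pairing q D f + pairing q E f"
proof -
  let ?A = "Poly_Mapping.keys D \<union> Poly_Mapping.keys E"
  show ?thesis using keys_add[of D E]
    by (simp add: pairing_superset[of ?A] lookup_add distrib_right sum.distrib)
qed

lemma pairing_diff_left: "pairing q (D - E) f = pairing q D f - pairing q E f"
  using pairing_add_left[of q "D - E" E f] by simp

lemma lookup_cscale: "Poly_Mapping.lookup (cscale c D) \<alpha> = c * Poly_Mapping.lookup D \<alpha>"
  by (simp add: cscale_def Poly_Mapping.map.rep_eq when_def)

lemma keys_cscale: "Poly_Mapping.keys (cscale c D) \<subseteq> Poly_Mapping.keys D"
  by (auto simp: in_keys_iff lookup_cscale)

lemma pairing_cscale: "pairing q (cscale c D) f = c * pairing q D f"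
  by (simp add: pairing_superset[OF finite_keys keys_cscale] lookup_cscale)
    (simp add: pairing_def sum_distrib_left mult.assoc)

lemma pairing_sum_left: "pairing q (\<Sum>x\<in>A. D x) f = (\<Sum>x\<in>A. pairing q (D x) f)"
  by (induction A rule: infinite_finite_induct) (auto simp: pairing_add_left)

lemma pairing_vanish:
  assumes "f \<in> vanish q L" "\<And>\<alpha>. \<alpha> \<in> Poly_Mapping.keys D \<Longrightarrow> mdeg \<alpha> < L"
  shows "pairing q D f = 0"
  unfolding pairing_def using assms by (intro sum.neutral) (auto simp: vanish_def)

lemma eval_apply_const: "eval q (apply_const D f) = pairing q D f"
  by (simp add: apply_const_def pairing_def)

lemma lookup_specialize: "Poly_Mapping.lookup (specialize q N) \<alpha> = eval q (Poly_Mapping.lookup N \<alpha>)"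
  by (simp add: specialize_def Poly_Mapping.map.rep_eq when_def)

lemma keys_specialize: "Poly_Mapping.keys (specialize q N) \<subseteq> Poly_Mapping.keys N"
  by (auto simp: in_keys_iff lookup_specialize)

text \<open>At \<open>q\<close> an operator acts through its specialization, so the theorem becomes
  a statement about linear functionals on \<open>R\<close>.\<close>

lemma eval_apply_weyl: "eval q (apply_weyl N f) = pairing q (specialize q N) f"
  by (simp add: apply_weyl_def pairing_superset[OF finite_keys keys_specialize] lookup_specialize)

lemma apply_weyl_add: "apply_weyl D (f + g) = apply_weyl D f + apply_weyl D g"
  by (simp add: apply_weyl_def dpow_add distrib_left sum.distrib)

lemma apply_weyl_diff: "apply_weyl D (f - g) = apply_weyl D f - apply_weyl D g"
  by (simp add: apply_weyl_def dpow_diff right_diff_distrib sum_subtractf)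

lemma apply_weyl_0 [simp]: "apply_weyl D 0 = 0"
  by (simp add: apply_weyl_def)

lemma apply_weyl_sum: "apply_weyl D (\<Sum>x\<in>A. f x) = (\<Sum>x\<in>A. apply_weyl D (f x))"
  by (induction A rule: infinite_finite_induct) (auto simp: apply_weyl_add)

lemma apply_weyl_closed: "D \<in> weyl_ops n \<Longrightarrow> f \<in> polys n \<Longrightarrow> apply_weyl D f \<in> polys n"
  by (simp add: apply_weyl_def weyl_ops_def polys_eq dpow_closed)

lemma dpow_mult_const_vars:
  assumes "b \<in> polys_in V" "\<alpha> \<in> monoms_in W" "V \<inter> W = {}"
  shows "dpow \<alpha> (b * f) = b * dpow \<alpha> f"
  using assms(1)
proof (induction b rule: polys_in_induct)
  case (var b i)
  then have "Poly_Mapping.lookup \<alpha> i = 0" using assms(2,3) by (auto simp: monoms_in_def in_keys_iff)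
  then show ?case using var by (simp add: mult.assoc dpow_Var_mult)
qed (auto simp: dpow_Const_mult dpow_add distrib_right)

text \<open>Here the restriction to derivatives in \<open>x\<close> enters: such operators are
  \<open>K[t]\<close>-linear, hence compatible with passing to a fibre.\<close>

lemma apply_weyl_mult_t:
  assumes "x_only d n D" "b \<in> polys_in {..<d}"
  shows "apply_weyl D (b * f) = b * apply_weyl D f"
  unfolding apply_weyl_def sum_distrib_left
proof (rule sum.cong)
  fix \<alpha> assume "\<alpha> \<in> Poly_Mapping.keys D"
  then have "dpow \<alpha> (b * f) = b * dpow \<alpha> f"
    using assms by (intro dpow_mult_const_vars[of _ "{..<d}" _ "{d..<n}"]) (auto simp: x_only_def)
  then show "Poly_Mapping.lookup D \<alpha> * dpow \<alpha> (b * f) = b * (Poly_Mapping.lookup D \<alpha> * dpow \<alpha> f)"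
    by (simp add: ac_simps)
qed simp

text \<open>The witness is the product of the linear factors \<open>x_i - q_i\<close> with
  multiplicities \<alpha>, built one factor at a time. Its only derivative that is nonzero at
  \<open>q\<close> is a product of factorials, nonzero in characteristic 0.\<close>

lemma dpow_dual_poly:
  fixes q :: "nat \<Rightarrow> 'k::field_char_0"
  assumes "\<alpha> \<in> monoms_in V"
  shows "\<exists>f\<in>polys_in V. \<forall>\<beta>. eval q (dpow \<beta> f) \<noteq> 0 \<longleftrightarrow> \<beta> = \<alpha>"
  using assms
proof (induction rule: monom_induct)
  case zero
  have "eval q (dpow \<beta> 1) \<noteq> 0 \<longleftrightarrow> \<beta> = 0" for \<beta>
  proof (cases "Poly_Mapping.keys \<beta> = {}")
    case True
    then have "\<beta> = 0" by (intro poly_mapping_eqI) (auto simp: in_keys_iff)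
    then show ?thesis
      using dpow_single[of 0 0 "1::'k"] by (simp add: dcoeff_def)
  next
    case False
    then obtain j where j: "j \<in> Poly_Mapping.keys \<beta>" by blast
    then have "(\<Prod>k<Poly_Mapping.lookup \<beta> j. (0::nat) - k) = 0"
      by (intro prod_zero bexI[of _ 0]) (auto simp: in_keys_iff)
    then have "dcoeff \<beta> 0 = 0" using j unfolding dcoeff_def by (intro prod_zero) auto
    then show ?thesis using dpow_single[of \<beta> 0 "1::'k"] j by auto
  qed
  then show ?case by (intro bexI[of _ 1]) auto
next
  case (add \<alpha> i)
  then obtain f where f: "f \<in> polys_in V" "\<And>\<beta>. eval q (dpow \<beta> f) \<noteq> 0 \<longleftrightarrow> \<beta> = \<alpha>" by auto
  let ?g = "(Var i - Const (q i)) * f"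
  have "eval q (dpow \<beta> ?g) = of_nat (Poly_Mapping.lookup \<beta> i) * eval q (dpow (\<beta> - Poly_Mapping.single i 1) f)" for \<beta>
    by (simp add: left_diff_distrib dpow_diff dpow_Var_mult dpow_Const_mult)
  then have "eval q (dpow \<beta> ?g) \<noteq> 0 \<longleftrightarrow>
      Poly_Mapping.lookup \<beta> i \<noteq> 0 \<and> \<beta> - Poly_Mapping.single i 1 = \<alpha>" for \<beta>
    using f(2) by simp
  moreover have "Poly_Mapping.lookup \<beta> i \<noteq> 0 \<and> \<beta> - Poly_Mapping.single i 1 = \<alpha> \<longleftrightarrow>
      \<beta> = \<alpha> + Poly_Mapping.single i 1" for \<beta>
  proof
    assume "Poly_Mapping.lookup \<beta> i \<noteq> 0 \<and> \<beta> - Poly_Mapping.single i 1 = \<alpha>"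
    then show "\<beta> = \<alpha> + Poly_Mapping.single i 1"
      by (intro poly_mapping_eqI) (auto simp: lookup_add lookup_minus lookup_single when_def)
  qed (simp add: lookup_add)
  ultimately show ?case using f(1) add by (intro bexI[of _ ?g]) auto
qed

text \<open>The pairing is nondegenerate on the side of the operators: the dual polynomial of a
  monomial isolates one coefficient of \<open>D\<close>.\<close>

lemma const_op_eq_0I:
  fixes q :: "nat \<Rightarrow> 'k::field_char_0"
  assumes "D \<in> const_ops n" "\<And>f. f \<in> polys n \<Longrightarrow> pairing q D f = 0"
  shows "D = 0"
proof (rule poly_mapping_eqI)
  fix \<alpha>
  show "Poly_Mapping.lookup D \<alpha> = Poly_Mapping.lookup 0 \<alpha>"
  proof (rule ccontr)
    assume n0: "Poly_Mapping.lookup D \<alpha> \<noteq> Poly_Mapping.lookup 0 \<alpha>"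
    then have \<alpha>: "\<alpha> \<in> Poly_Mapping.keys D" by (simp add: in_keys_iff)
    then obtain f where f: "f \<in> polys_in {..<n}" "\<And>\<beta>. eval q (dpow \<beta> f) \<noteq> 0 \<longleftrightarrow> \<beta> = \<alpha>"
      using dpow_dual_poly[of \<alpha> "{..<n}" q] assms(1) by (auto simp: const_ops_def)
    have "pairing q D f = Poly_Mapping.lookup D \<alpha> * eval q (dpow \<alpha> f)"
    proof -
      have "(\<Sum>\<beta>\<in>Poly_Mapping.keys D - {\<alpha>}. Poly_Mapping.lookup D \<beta> * eval q (dpow \<beta> f)) = 0"
      proof (rule sum.neutral, rule ballI)
        fix \<beta> assume "\<beta> \<in> Poly_Mapping.keys D - {\<alpha>}"
        then have "eval q (dpow \<beta> f) = 0" using f(2)[of \<beta>] by blast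
        then show "Poly_Mapping.lookup D \<beta> * eval q (dpow \<beta> f) = 0" by simp
      qed
      then show ?thesis unfolding pairing_def by (subst sum.remove[OF finite_keys \<alpha>]) simp
    qed
    then show False using n0 f assms(2)[of f] by (auto simp: polys_eq)
  qed
qed

lemma functional_in_span:
  fixes \<phi> :: "'k::field mpoly \<Rightarrow> 'k" and s :: "'i \<Rightarrow> 'k mpoly \<Rightarrow> 'k"
  defines "lin \<equiv> \<lambda>\<phi>::'k mpoly \<Rightarrow> 'k. \<forall>f g c. \<phi> (f + Const c * g) = \<phi> f + c * \<phi> g"
  assumes "finite S" "\<And>i. i \<in> S \<Longrightarrow> lin (s i)" "lin \<phi>"
    and "\<And>f. f \<in> polys_in V \<Longrightarrow> (\<And>i. i \<in> S \<Longrightarrow> s i f = 0) \<Longrightarrow> \<phi> f = 0"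
  shows "\<exists>c. \<forall>f\<in>polys_in V. \<phi> f = (\<Sum>i\<in>S. c i * s i f)"
  using assms(2-)
proof (induction S arbitrary: \<phi> rule: finite_induct)
  case empty
  then show ?case by simp
next
  case (insert i S)
  note lin = insert.prems(1)[of i, unfolded lin_def, simplified] insert.prems(2)[unfolded lin_def]
  show ?case
  proof (cases "\<forall>f\<in>polys_in V. (\<forall>j\<in>S. s j f = 0) \<longrightarrow> s i f = 0")
    case True
    have "\<exists>c. \<forall>f\<in>polys_in V. \<phi> f = (\<Sum>j\<in>S. c j * s j f)"
    proof (rule insert.IH)
      fix f assume "f \<in> polys_in V" "\<And>j. j \<in> S \<Longrightarrow> s j f = 0"
      then show "\<phi> f = 0" using True insert.prems(3)[of f] by blast
    qed (use insert.prems in auto)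
    then obtain c where c: "\<And>f. f \<in> polys_in V \<Longrightarrow> \<phi> f = (\<Sum>j\<in>S. c j * s j f)" by blast
    have "\<phi> f = (\<Sum>j\<in>insert i S. (c(i := 0)) j * s j f)" if "f \<in> polys_in V" for f
      using c[OF that] insert.hyps by (auto intro!: sum.cong)
    then show ?thesis by blast
  next
    case False
    then obtain u where u: "u \<in> polys_in V" "\<And>j. j \<in> S \<Longrightarrow> s j u = 0" "s i u \<noteq> 0" by auto
    define e where "e = \<phi> u / s i u"
    define \<psi> where "\<psi> = (\<lambda>f. \<phi> f - e * s i f)"
    have "\<exists>c. \<forall>f\<in>polys_in V. \<psi> f = (\<Sum>j\<in>S. c j * s j f)"
    proof (rule insert.IH)
      show "lin \<psi>" unfolding lin_def \<psi>_def using lin by (simp add: algebra_simps)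
      fix f assume f: "f \<in> polys_in V" "\<And>j. j \<in> S \<Longrightarrow> s j f = 0"
      \<comment> \<open>Correcting \<open>f\<close> by a multiple of \<open>u\<close> makes
        \<open>s i\<close> vanish and leaves the other functionals at 0, so that the hypothesis on
        \<phi> applies.\<close>
      let ?g = "f + Const (- s i f / s i u) * u"
      have "\<phi> ?g = 0"
      proof (rule insert.prems(3))
        fix j assume "j \<in> insert i S"
        then show "s j ?g = 0"
          using lin u f insert.prems(1)[of j] by (auto simp: lin_def)
      qed (use f u in auto)
      then show "\<psi> f = 0" using lin u by (simp add: \<psi>_def e_def field_simps)
    qed (use insert.prems in auto)
    then obtain c where c: "\<And>f. f \<in> polys_in V \<Longrightarrow> \<psi> f = (\<Sum>j\<in>S. c j * s j f)" by blast
    have "\<phi> f = (\<Sum>j\<in>insert i S. (c(i := e)) j * s j f)" if "f \<in> polys_in V" for f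
    proof -
      have "(\<Sum>j\<in>S. (c(i := e)) j * s j f) = (\<Sum>j\<in>S. c j * s j f)"
        using insert.hyps by (auto intro!: sum.cong)
      then show ?thesis using c[OF that] insert.hyps by (simp add: \<psi>_def algebra_simps)
    qed
    then show ?thesis by blast
  qed
qed

text \<open>The duality step: \<open>functional_in_span\<close> gives an equality of functionals on
  \<open>R\<close>, which nondegeneracy turns into one of operators.\<close>

lemma const_ops_cspan:
  fixes q :: "nat \<Rightarrow> 'k::field_char_0"
  assumes "finite S" "S \<subseteq> const_ops n" "D \<in> const_ops n"
    and "\<And>f. f \<in> polys n \<Longrightarrow> (\<And>E. E \<in> S \<Longrightarrow> pairing q E f = 0) \<Longrightarrow> pairing q D f = 0"
  shows "D \<in> cspan S"
proof -
  obtain c where c: "\<And>f. f \<in> polys n \<Longrightarrow> pairing q D f = (\<Sum>E\<in>S. c E * pairing q E f)"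
    using functional_in_span[of S "pairing q" "pairing q D" "{..<n}"] assms
    by (auto simp: polys_eq pairing_add_right pairing_Const_right)
  let ?E = "\<Sum>E\<in>S. cscale (c E) E"
  have "D - ?E = 0"
  proof (rule const_op_eq_0I)
    have "Poly_Mapping.keys ?E \<subseteq> (\<Union>E\<in>S. Poly_Mapping.keys E)"
    proof (rule order_trans[OF keys_sum], rule UN_mono[OF subset_refl])
      fix E show "Poly_Mapping.keys (cscale (c E) E) \<subseteq> Poly_Mapping.keys E"
        by (rule keys_cscale)
    qed
    then have "?E \<in> const_ops n" using assms(2) by (auto simp: const_ops_def)
    then show "D - ?E \<in> const_ops n"
      using assms(3) keys_diff[of D ?E] by (auto simp: const_ops_def)
    fix f :: "'k mpoly" assume "f \<in> polys n"
    then show "pairing q (D - ?E) f = 0"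
      by (simp add: pairing_diff_left pairing_sum_left pairing_cscale c)
  qed
  then show ?thesis using assms(1) by (auto simp: cspan_def)
qed

section \<open>Ideals\<close>

lemma ideal_0: "is_ideal n J \<Longrightarrow> 0 \<in> J"
  by (simp add: is_ideal_def)

lemma ideal_add: "is_ideal n J \<Longrightarrow> f \<in> J \<Longrightarrow> g \<in> J \<Longrightarrow> f + g \<in> J"
  by (simp add: is_ideal_def)

lemma ideal_mult: "is_ideal n J \<Longrightarrow> f \<in> J \<Longrightarrow> r \<in> polys n \<Longrightarrow> r * f \<in> J"
  by (simp add: is_ideal_def)

lemma ideal_mult_right: "is_ideal n J \<Longrightarrow> f \<in> J \<Longrightarrow> r \<in> polys n \<Longrightarrow> f * r \<in> J"
  using ideal_mult[of n J f r] by (simp add: mult.commute)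

lemma ideal_subset: "is_ideal n J \<Longrightarrow> f \<in> J \<Longrightarrow> f \<in> polys n"
  by (auto simp: is_ideal_def)

lemma ideal_uminus: "is_ideal n J \<Longrightarrow> f \<in> J \<Longrightarrow> - f \<in> J"
  using ideal_mult[of n J f "-1"] by (simp add: polys_eq)

lemma ideal_diff: "is_ideal n J \<Longrightarrow> f \<in> J \<Longrightarrow> g \<in> J \<Longrightarrow> f - g \<in> J"
  using ideal_add[of n J f "- g"] ideal_uminus[of n J g] by simp

lemma ideal_sum: "is_ideal n J \<Longrightarrow> (\<And>x. x \<in> A \<Longrightarrow> f x \<in> J) \<Longrightarrow> sum f A \<in> J"
  by (induction A rule: infinite_finite_induct) (auto intro: ideal_0 ideal_add)

lemma ideal_diff_sym: "is_ideal n J \<Longrightarrow> f - g \<in> J \<Longrightarrow> g - f \<in> J"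
  using ideal_uminus[of n J "f - g"] by simp

lemma ideal_diff_cancel: "is_ideal n J \<Longrightarrow> f - g \<in> J \<Longrightarrow> g \<in> J \<Longrightarrow> f \<in> J"
  using ideal_add[of n J "f - g" g] by simp

lemma ideal_eq_iff_diff: "is_ideal n J \<Longrightarrow> f - g \<in> J \<Longrightarrow> f \<in> J \<longleftrightarrow> g \<in> J"
  by (metis ideal_diff_cancel ideal_diff_sym)

section \<open>Sums with a principal ideal, and primes avoiding a multiplicative set\<close>

definition ideal_plus :: "nat \<Rightarrow> ('k::comm_ring_1) mpoly set \<Rightarrow> 'k mpoly \<Rightarrow> 'k mpoly set" where
  "ideal_plus n J f = {m + r * f | m r. m \<in> J \<and> r \<in> polys n}"

lemma ideal_plus_ideal:
  assumes "is_ideal n J" "f \<in> polys n"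
  shows "is_ideal n (ideal_plus n J f)"
  unfolding is_ideal_def
proof (intro conjI ballI)
  show "ideal_plus n J f \<subseteq> polys n"
    using assms by (auto simp: ideal_plus_def is_ideal_def polys_eq)
  show "0 \<in> ideal_plus n J f"
    unfolding ideal_plus_def using assms
    by (auto simp: is_ideal_def polys_eq intro!: exI[of _ 0])
  fix g assume "g \<in> ideal_plus n J f"
  then obtain m r where g: "g = m + r * f" "m \<in> J" "r \<in> polys n" by (auto simp: ideal_plus_def)
  {
    fix h assume "h \<in> ideal_plus n J f"
    then obtain m' r' where h: "h = m' + r' * f" "m' \<in> J" "r' \<in> polys n" by (auto simp: ideal_plus_def)
    have "g + h = (m + m') + (r + r') * f" by (simp add: g h algebra_simps)
    moreover have "m + m' \<in> J" "r + r' \<in> polys n"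
      using g h assms by (auto simp: is_ideal_def polys_eq)
    ultimately show "g + h \<in> ideal_plus n J f" unfolding ideal_plus_def by blast
  }
  {
    fix s :: "'a mpoly" assume s: "s \<in> polys n"
    have "s * g = s * m + (s * r) * f" by (simp add: g algebra_simps)
    moreover have "s * m \<in> J" "s * r \<in> polys n"
      using g s assms by (auto simp: is_ideal_def polys_eq)
    ultimately show "s * g \<in> ideal_plus n J f" unfolding ideal_plus_def by blast
  }
qed

lemma ideal_plus_subset: "J \<subseteq> ideal_plus n J f"
proof
  fix m assume "m \<in> J"
  moreover have "m = m + 0 * f" by simp
  moreover have "0 \<in> polys n" by (simp add: polys_eq)
  ultimately show "m \<in> ideal_plus n J f" unfolding ideal_plus_def by blast
qed

lemma ideal_plus_mem: "is_ideal n J \<Longrightarrow> f \<in> ideal_plus n J f"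
proof -
  assume J: "is_ideal n J"
  have "f = 0 + 1 * f" by simp
  moreover have "0 \<in> J" "1 \<in> polys n" using J by (simp_all add: ideal_0 polys_eq)
  ultimately show ?thesis unfolding ideal_plus_def by blast
qed

text \<open>By Zorn there is an ideal \<open>M\<close> maximal among those that contain
  \<open>J\<close> and miss \<open>S\<close>. If \<open>f\<close> and \<open>g\<close> lie outside
  \<open>M\<close>, then \<open>M + (f)\<close> and \<open>M + (g)\<close> meet \<open>S\<close>;
  the product of two such elements is in \<open>S\<close>, and would be in \<open>M\<close> if
  \<open>f * g\<close> were.\<close>

lemma prime_ideal_avoiding:
  assumes J: "is_ideal n J" and S: "1 \<in> S" "\<And>s t. s \<in> S \<Longrightarrow> t \<in> S \<Longrightarrow> s * t \<in> S"
    and disj: "J \<inter> S = {}"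
  obtains P where "is_prime_ideal n P" "J \<subseteq> P" "P \<inter> S = {}"
proof -
  define \<A> where "\<A> = {K. is_ideal n K \<and> J \<subseteq> K \<and> K \<inter> S = {}}"
  have "\<exists>M\<in>\<A>. \<forall>X\<in>\<A>. M \<subseteq> X \<longrightarrow> X = M"
  proof (rule subset_Zorn_nonempty)
    show "\<A> \<noteq> {}" using J disj by (auto simp: \<A>_def)
    fix C assume C: "C \<noteq> {}" "subset.chain \<A> C"
    then have sub: "K \<in> \<A>" if "K \<in> C" for K using that by (auto simp: subset.chain_def)
    have "is_ideal n (\<Union>C)" unfolding is_ideal_def
    proof (intro conjI ballI)
      show "\<Union>C \<subseteq> polys n" "0 \<in> \<Union>C"
        using sub C(1) by (force simp: \<A>_def is_ideal_def)+
      fix f assume "f \<in> \<Union>C"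
      then obtain K where K: "K \<in> C" "f \<in> K" by blast
      {
        fix g assume "g \<in> \<Union>C"
        then obtain L where L: "L \<in> C" "g \<in> L" by blast
        then have "K \<subseteq> L \<or> L \<subseteq> K" using C(2) K by (auto simp: subset.chain_def)
        then show "f + g \<in> \<Union>C"
          using K L sub[of K] sub[of L] ideal_add[of n] unfolding \<A>_def by blast
      }
      fix r :: "'a mpoly" assume "r \<in> polys n"
      then show "r * f \<in> \<Union>C" using K sub[of K] ideal_mult[of n] unfolding \<A>_def by blast
    qed
    then show "\<Union>C \<in> \<A>" using sub C(1) by (auto simp: \<A>_def)
  qed
  then obtain M where M: "is_ideal n M" "J \<subseteq> M" "M \<inter> S = {}"
    and max: "\<And>X. X \<in> \<A> \<Longrightarrow> M \<subseteq> X \<Longrightarrow> X = M" by (auto simp: \<A>_def)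
  have meets: "\<exists>m r. m \<in> M \<and> r \<in> polys n \<and> m + r * f \<in> S" if f: "f \<in> polys n" "f \<notin> M" for f
  proof (rule ccontr)
    assume n: "\<nexists>m r. m \<in> M \<and> r \<in> polys n \<and> m + r * f \<in> S"
    have "ideal_plus n M f \<in> \<A>"
      using ideal_plus_ideal[OF M(1) f(1)] ideal_plus_subset[of M n f] M n
      unfolding \<A>_def by (auto simp: ideal_plus_def)
    from max[OF this ideal_plus_subset] show False
      using ideal_plus_mem[OF M(1)] f(2) by blast
  qed
  have "is_prime_ideal n M" unfolding is_prime_ideal_def
  proof (intro conjI ballI impI)
    show "is_ideal n M" "1 \<notin> M" using M S by auto
    fix f g assume fg: "f \<in> polys n" "g \<in> polys n" "f * g \<in> M"
    show "f \<in> M \<or> g \<in> M"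
    proof (rule ccontr)
      assume "\<not> (f \<in> M \<or> g \<in> M)"
      then obtain m r m' r' where m: "m \<in> M" "r \<in> polys n" "m + r * f \<in> S"
        "m' \<in> M" "r' \<in> polys n" "m' + r' * g \<in> S"
        using meets fg by metis
      have "m * (m' + r' * g) \<in> M" "(r * f) * m' \<in> M" "(r * r') * (f * g) \<in> M"
        using m fg ideal_subset[OF M(1) m(4)]
          ideal_mult_right[OF M(1) m(1), of "m' + r' * g"] ideal_mult[OF M(1) m(4), of "r * f"]
          ideal_mult[OF M(1) fg(3), of "r * r'"] by (auto simp: polys_eq)
      then have "m * (m' + r' * g) + (r * f) * m' + (r * r') * (f * g) \<in> M"
        by (intro ideal_add[OF M(1)])
      also have "m * (m' + r' * g) + (r * f) * m' + (r * r') * (f * g) = (m + r * f) * (m' + r' * g)"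
        by (simp add: algebra_simps)
      finally show False using S(2) m M(3) by blast
    qed
  qed
  then show ?thesis using that M by blast
qed

lemma radical_prime:
  assumes "is_primary_ideal n I"
  shows "is_prime_ideal n (radical n I)"
proof -
  have I: "is_ideal n I" using assms by (simp add: is_primary_ideal_def)
  have "is_ideal n (radical n I)" unfolding is_ideal_def
  proof (intro conjI ballI)
    show "radical n I \<subseteq> polys n" by (auto simp: radical_def)
    show "0 \<in> radical n I" using ideal_0[OF I] by (auto simp: radical_def polys_eq intro!: exI[of _ 1])
    fix f assume "f \<in> radical n I"
    then obtain k where f: "f \<in> polys n" "f ^ k \<in> I" by (auto simp: radical_def)
    {
      fix g assume "g \<in> radical n I"
      then obtain l where g: "g \<in> polys n" "g ^ l \<in> I" by (auto simp: radical_def)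
      \<comment> \<open>In each binomial term either \<open>i\<close> is at least \<open>k\<close>
        or \<open>k + l - i\<close> is at least \<open>l\<close>.\<close>
      have "(f + g) ^ (k + l) \<in> I"
        unfolding binomial_ring
      proof (rule ideal_sum[OF I])
        fix i assume i: "i \<in> {..k + l}"
        show "of_nat (k + l choose i) * f ^ i * g ^ (k + l - i) \<in> I"
        proof (cases "k \<le> i")
          case True
          then have "f ^ i = f ^ (i - k) * f ^ k" by (simp flip: power_add)
          then have "of_nat (k + l choose i) * f ^ i * g ^ (k + l - i) =
             (of_nat (k + l choose i) * f ^ (i - k) * g ^ (k + l - i)) * f ^ k" by (simp add: ac_simps)
          then show ?thesis using ideal_mult[OF I f(2)] f g by (simp add: polys_eq)
        next
          case False
          then have "g ^ (k + l - i) = g ^ (k - i) * g ^ l" by (simp flip: power_add)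
          then have "of_nat (k + l choose i) * f ^ i * g ^ (k + l - i) =
             (of_nat (k + l choose i) * f ^ i * g ^ (k - i)) * g ^ l" by (simp add: ac_simps)
          then show ?thesis using ideal_mult[OF I g(2)] f g by (simp add: polys_eq)
        qed
      qed
      then show "f + g \<in> radical n I" using f g by (auto simp: radical_def polys_eq)
    }
    fix r :: "'a mpoly" assume "r \<in> polys n"
    then show "r * f \<in> radical n I" using f ideal_mult[OF I f(2), of "r ^ k"]
      by (auto simp: radical_def polys_eq power_mult_distrib)
  qed
  moreover have "1 \<notin> radical n I" using assms by (auto simp: radical_def is_primary_ideal_def)
  moreover have "f \<in> radical n I \<or> g \<in> radical n I"
    if fg: "f \<in> polys n" "g \<in> polys n" "f * g \<in> radical n I" for f g
  proof -
    obtain k where "f ^ k * g ^ k \<in> I"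
      using fg(3) unfolding radical_def mem_Collect_eq power_mult_distrib by blast
    then have "f ^ k \<in> I \<or> (\<exists>l. (g ^ k) ^ l \<in> I)"
      using assms fg by (auto simp: is_primary_ideal_def polys_eq)
    then show ?thesis using fg by (auto simp: radical_def simp flip: power_mult)
  qed
  ultimately show ?thesis by (simp add: is_prime_ideal_def)
qed

section \<open>One distinguished variable, and points where a polynomial does not vanish\<close>

definition coeffs_in :: "nat set \<Rightarrow> ('k::comm_ring_1) mpoly poly \<Rightarrow> bool" where
  "coeffs_in V p \<longleftrightarrow> (\<forall>i. coeff p i \<in> polys_in V)"

lemma poly_closed: "coeffs_in V p \<Longrightarrow> V \<subseteq> W \<Longrightarrow> x \<in> polys_in W \<Longrightarrow> poly p x \<in> polys_in W"
  using polys_in_mono[of V W] unfolding poly_altdef coeffs_in_def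
  by (intro polys_in_sum polys_in_mult polys_in_power) auto

lemma polys_in_insert:
  assumes "f \<in> polys_in (insert j V)"
  obtains p where "coeffs_in V p" "poly p (Var j) = f"
proof -
  have "\<exists>p. coeffs_in V p \<and> poly p (Var j) = f"
    using assms
  proof (induction f rule: polys_in_induct)
    case (const c)
    show ?case by (rule exI[of _ "[:Const c:]"]) (auto simp: coeffs_in_def coeff_pCons split: nat.splits)
  next
    case (add f g)
    then obtain p q where "coeffs_in V p" "poly p (Var j) = f" "coeffs_in V q" "poly q (Var j) = g" by blast
    then show ?case by (intro exI[of _ "p + q"]) (auto simp: coeffs_in_def)
  next
    case (var f i)
    then obtain p where p: "coeffs_in V p" "poly p (Var j) = f" by blast
    show ?case
    proof (cases "i = j")
      case True
      then show ?thesis using p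
        by (intro exI[of _ "pCons 0 p"]) (auto simp: coeffs_in_def coeff_pCons split: nat.splits)
    next
      case False
      then show ?thesis using p var
        by (intro exI[of _ "smult (Var i) p"]) (auto simp: coeffs_in_def)
    qed
  qed
  then show ?thesis using that by blast
qed

lemma eval_cong:
  assumes "f \<in> polys_in V" "\<And>i. i \<in> V \<Longrightarrow> q i = q' i"
  shows "eval q f = eval q' f"
  using assms(1) by (induction f rule: polys_in_induct) (auto simp: assms(2))

lemma eval_poly: "eval q (poly p x) = poly (map_poly (eval q) p) (eval q x)"
  by (induction p) (auto simp: map_poly_pCons)

lemma ex_nonroot:
  fixes p :: "'k::field_char_0 poly"
  assumes "p \<noteq> 0" shows "\<exists>a. poly p a \<noteq> 0"
  using poly_roots_finite[OF assms] infinite_UNIV_char_0[where 'a='k]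
  by (metis (mono_tags, lifting) Collect_cong UNIV_def)

lemma polys_in_empty:
  assumes "f \<in> polys_in {}"
  obtains c where "f = Const c"
proof -
  have "\<exists>c. f = Const c" using assms
    by (induction f rule: polys_in_induct) (auto simp flip: Const_add)
  then show ?thesis using that by blast
qed

text \<open>Seen as a polynomial in \<open>Var j\<close>, \<open>f\<close> has a nonzero
  coefficient. Specialize the other variables where that coefficient survives, then avoid the
  finitely many roots in an infinite field. Coordinates outside \<open>V\<close> are set to 0 so
  that the point lies in \<open>points d\<close> when \<open>V\<close> is the set of
  t-variables.\<close>

lemma ex_nonvanishing_point:
  fixes f :: "'k::field_char_0 mpoly"
  assumes "finite V" "f \<in> polys_in V" "f \<noteq> 0"
  shows "\<exists>q. eval q f \<noteq> 0 \<and> (\<forall>i. i \<notin> V \<longrightarrow> q i = 0)"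
  using assms
proof (induction V arbitrary: f rule: finite_induct)
  case empty
  then obtain c where "f = Const c" using polys_in_empty by blast
  then show ?case using empty by (intro exI[of _ "\<lambda>_. 0"]) auto
next
  case (insert j V)
  obtain p where p: "coeffs_in V p" "poly p (Var j) = f" using insert.prems(1) by (rule polys_in_insert)
  then have "p \<noteq> 0" using insert.prems(2) by auto
  then obtain i where i: "coeff p i \<noteq> 0" by (auto simp: poly_eq_iff)
  then obtain q where q: "eval q (coeff p i) \<noteq> 0" "\<And>i. i \<notin> V \<Longrightarrow> q i = 0"
    using insert.IH[of "coeff p i"] p by (auto simp: coeffs_in_def)
  then have "map_poly (eval q) p \<noteq> 0"
    by (metis coeff_0 coeff_map_poly eval_zero)
  then obtain a where a: "poly (map_poly (eval q) p) a \<noteq> 0" using ex_nonroot by blast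
  let ?q = "q(j := a)"
  have "eval ?q (coeff p k) = eval q (coeff p k)" for k
    by (rule eval_cong[of _ V]) (use p insert.hyps in \<open>auto simp: coeffs_in_def\<close>)
  then have "map_poly (eval ?q) p = map_poly (eval q) p"
    by (intro poly_eqI) (simp add: coeff_map_poly)
  then have "eval ?q f \<noteq> 0" using a by (simp flip: p(2) add: eval_poly)
  moreover have "\<forall>i. i \<notin> insert j V \<longrightarrow> ?q i = 0" using q by simp
  ultimately show ?case by blast
qed

lemma eval_line: "\<exists>A. \<forall>l. eval (\<lambda>i. y i + l * (z i - y i)) f = poly A l"
proof (induction f rule: polys_in_induct[OF polys_in_UNIV, case_names const add var])
  case (const c)
  show ?case by (rule exI[of _ "[:c:]"]) simp
next
  case (add f g)
  then obtain A B where "\<forall>l. eval (\<lambda>i. y i + l * (z i - y i)) f = poly A l"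
    "\<forall>l. eval (\<lambda>i. y i + l * (z i - y i)) g = poly B l" by blast
  then show ?case by (intro exI[of _ "A + B"]) simp
next
  case (var f i)
  then obtain A where "\<forall>l. eval (\<lambda>i. y i + l * (z i - y i)) f = poly A l" by blast
  then show ?case by (intro exI[of _ "[:y i, z i - y i:] * A"]) (simp add: algebra_simps)
qed

text \<open>On the line \<open>f\<close> and \<open>g\<close> become univariate polynomials, nonzero
  because of their values at 0 and 1. A line is used because in \<open>prime_step\<close> the common
  point must stay in a hyperplane containing \<open>y\<close> and \<open>z\<close>.\<close>

lemma ex_common_nonvanishing_on_line:
  fixes y z :: "nat \<Rightarrow> 'k::field_char_0"
  assumes "eval y f \<noteq> 0" "eval z g \<noteq> 0"
  shows "\<exists>l. eval (\<lambda>i. y i + l * (z i - y i)) f \<noteq> 0 \<and> eval (\<lambda>i. y i + l * (z i - y i)) g \<noteq> 0"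
proof -
  obtain A where A: "\<And>l. eval (\<lambda>i. y i + l * (z i - y i)) f = poly A l" using eval_line[of y z f] by blast
  obtain B where B: "\<And>l. eval (\<lambda>i. y i + l * (z i - y i)) g = poly B l" using eval_line[of y z g] by blast
  have "poly A 0 \<noteq> 0" "poly B 1 \<noteq> 0" using assms by (simp_all flip: A B)
  then have "A * B \<noteq> 0" by auto
  from ex_nonroot[OF this] show ?thesis by (auto simp: A B)
qed

section \<open>Independent variables and chains of primes\<close>

definition indep :: "nat set \<Rightarrow> ('k::comm_ring_1) mpoly set \<Rightarrow> bool" where
  "indep V P \<longleftrightarrow> (\<forall>f\<in>polys_in V. f \<in> P \<longrightarrow> f = 0)"

section \<open>Finite generation modulo P after inverting one element\<close>

definition lspan :: "nat set \<Rightarrow> ('k::comm_ring_1) mpoly set \<Rightarrow> 'k mpoly set" where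
  "lspan V G = {\<Sum>v\<in>G. c v * v | c. \<forall>v\<in>G. c v \<in> polys_in V}"

lemma lspan_add: "s \<in> lspan V G \<Longrightarrow> t \<in> lspan V G \<Longrightarrow> s + t \<in> lspan V G"
proof -
  assume "s \<in> lspan V G" "t \<in> lspan V G"
  then obtain c e where c: "s = (\<Sum>v\<in>G. c v * v)" "t = (\<Sum>v\<in>G. e v * v)"
    "\<forall>v\<in>G. c v \<in> polys_in V" "\<forall>v\<in>G. e v \<in> polys_in V" by (auto simp: lspan_def)
  then have "s + t = (\<Sum>v\<in>G. (c v + e v) * v)" by (simp add: distrib_right sum.distrib)
  moreover have "\<forall>v\<in>G. c v + e v \<in> polys_in V" using c by simp
  ultimately show ?thesis unfolding lspan_def by (intro CollectI exI[of _ "\<lambda>v. c v + e v"]) simp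
qed

lemma lspan_mult: "s \<in> lspan V G \<Longrightarrow> b \<in> polys_in V \<Longrightarrow> b * s \<in> lspan V G"
proof -
  assume "s \<in> lspan V G" and b: "b \<in> polys_in V"
  then obtain c where c: "s = (\<Sum>v\<in>G. c v * v)" "\<forall>v\<in>G. c v \<in> polys_in V" by (auto simp: lspan_def)
  then have "b * s = (\<Sum>v\<in>G. (b * c v) * v)" by (simp add: sum_distrib_left mult.assoc)
  moreover have "\<forall>v\<in>G. b * c v \<in> polys_in V" using c b by simp
  ultimately show ?thesis unfolding lspan_def by (intro CollectI exI[of _ "\<lambda>v. b * c v"]) simp
qed

lemma lspan_0: "0 \<in> lspan V G"
  unfolding lspan_def by (intro CollectI exI[of _ "\<lambda>_. 0"]) simp

lemma lspan_base: "finite G \<Longrightarrow> v \<in> G \<Longrightarrow> v \<in> lspan V G"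
  unfolding lspan_def
  by (intro CollectI exI[of _ "\<lambda>w. if w = v then 1 else 0"]) (auto simp: if_distrib[of "\<lambda>x. x * _"] sum.delta cong: if_cong)

text \<open>The elements whose residues modulo \<open>P\<close> become
  \<open>K[V]\<close>-combinations of \<open>G\<close> once \<open>a\<close> is inverted; the power
  of \<open>a\<close> on the left stands for the denominator.\<close>

definition generated :: "nat set \<Rightarrow> ('k::comm_ring_1) mpoly set \<Rightarrow> 'k mpoly \<Rightarrow> 'k mpoly set \<Rightarrow> 'k mpoly set" where
  "generated V P a G = {g. \<exists>k. \<exists>s\<in>lspan V G. a ^ k * g - s \<in> P}"

lemma generated_add:
  assumes P: "is_ideal n P" and a: "V \<subseteq> {..<n}" "a \<in> polys_in V"
    and "g \<in> generated V P a G" "h \<in> generated V P a G"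
  shows "g + h \<in> generated V P a G"
proof -
  obtain k s l t where k: "s \<in> lspan V G" "a ^ k * g - s \<in> P" "t \<in> lspan V G" "a ^ l * h - t \<in> P"
    using assms(4,5) by (auto simp: generated_def)
  have an: "a ^ i \<in> polys n" for i using a polys_in_mono[of V "{..<n}"] by (auto simp: polys_eq)
  have "a ^ (k + l) * (g + h) - (a ^ l * s + a ^ k * t) = a ^ l * (a ^ k * g - s) + a ^ k * (a ^ l * h - t)"
    by (simp add: power_add algebra_simps)
  also have "\<dots> \<in> P" using k an by (intro ideal_add[OF P] ideal_mult[OF P])
  finally show ?thesis using k a unfolding generated_def
    by (intro CollectI exI[of _ "k + l"] bexI[of _ "a ^ l * s + a ^ k * t"] lspan_add lspan_mult) auto
qed

lemma generated_mult:
  assumes P: "is_ideal n P" and a: "V \<subseteq> {..<n}" "b \<in> polys_in V"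
    and "g \<in> generated V P a G"
  shows "b * g \<in> generated V P a G"
proof -
  obtain k s where k: "s \<in> lspan V G" "a ^ k * g - s \<in> P"
    using assms(4) by (auto simp: generated_def)
  have "b \<in> polys n" using a polys_in_mono[of V "{..<n}"] by (auto simp: polys_eq)
  then have "b * (a ^ k * g - s) \<in> P" using k by (intro ideal_mult[OF P])
  then have "a ^ k * (b * g) - b * s \<in> P" by (simp add: algebra_simps)
  then show ?thesis using k a unfolding generated_def
    by (intro CollectI exI[of _ k] bexI[of _ "b * s"] lspan_mult) auto
qed

lemma generated_sum:
  assumes P: "is_ideal n P" and a: "V \<subseteq> {..<n}" "a \<in> polys_in V"
    and "\<And>x. x \<in> X \<Longrightarrow> g x \<in> generated V P a G"
  shows "sum g X \<in> generated V P a G"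
  using assms(4)
proof (induction X rule: infinite_finite_induct)
  case (insert x X)
  then show ?case using generated_add[OF P a] by simp
qed (use ideal_0[OF P] lspan_0 in \<open>auto simp: generated_def intro!: bexI[of _ 0]\<close>)

lemma generated_cong:
  assumes P: "is_ideal n P" and a: "V \<subseteq> {..<n}" "a \<in> polys_in V"
    and "h \<in> generated V P a G" "a ^ l * g - h \<in> P"
  shows "g \<in> generated V P a G"
proof -
  obtain k s where k: "s \<in> lspan V G" "a ^ k * h - s \<in> P"
    using assms(4) by (auto simp: generated_def)
  have "a ^ k \<in> polys n" using a polys_in_mono[of V "{..<n}"] by (auto simp: polys_eq)
  then have "a ^ k * (a ^ l * g - h) + (a ^ k * h - s) \<in> P"
    using k assms by (intro ideal_add[OF P] ideal_mult[OF P])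
  then have "a ^ (k + l) * g - s \<in> P" by (simp add: algebra_simps power_add)
  then show ?thesis using k unfolding generated_def by blast
qed

lemma generated_base: "is_ideal n P \<Longrightarrow> s \<in> lspan V G \<Longrightarrow> s \<in> generated V P a G"
  unfolding generated_def
  by (intro CollectI exI[of _ 0] bexI[of _ s]) (auto simp: ideal_0)

lemma dependent_poly:
  assumes "\<not> indep (insert j V) P" "indep V P"
  obtains p where "coeffs_in V p" "poly p (Var j) \<in> P" "degree p > 0"
proof -
  obtain f where f: "f \<in> polys_in (insert j V)" "f \<in> P" "f \<noteq> 0"
    using assms(1) by (auto simp: indep_def)
  obtain p where p: "coeffs_in V p" "poly p (Var j) = f" using f(1) by (rule polys_in_insert)
  have "degree p \<noteq> 0"
  proof
    assume "degree p = 0"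
    then obtain c where c: "p = [:c:]" using degree_eq_zeroE by blast
    then have "c = f" using p by simp
    moreover have "c \<in> polys_in V" using p(1) c by (auto simp: coeffs_in_def dest: spec[of _ 0])
    ultimately show False using f assms(2) by (simp add: indep_def)
  qed
  then show ?thesis using that p f by blast
qed

text \<open>Inverting the leading coefficient of \<open>p\<close> makes \<open>Var j\<close>
  integral, so powers of it below \<open>degree p\<close> suffice: the new generators are their
  products with those of \<open>G\<close>, the new denominator is \<open>a\<close> times the leading
  coefficient.\<close>

lemma finitely_generated_step:
  fixes P :: "'k::idom mpoly set"
  assumes P: "is_ideal n P" and V: "V \<subseteq> {..<n}"
    and J: "insert j J \<subseteq> {..<n}" and G: "finite G" "G \<subseteq> polys n" and a: "a \<in> polys_in V" "a \<noteq> 0"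
    and gen: "polys_in (V \<union> J) \<subseteq> generated V P a G"
    and p: "coeffs_in V p" "poly p (Var j) \<in> P" "degree p > 0"
  shows "\<exists>G a. finite G \<and> G \<subseteq> polys n \<and> a \<in> polys_in V \<and> a \<noteq> 0 \<and>
    polys_in (V \<union> insert j J) \<subseteq> generated V P a G"
proof -
  let ?x = "Var j :: 'k mpoly"
  let ?b = "lead_coeff p"
  let ?D = "degree p"
  define G' where "G' = (\<lambda>(v, i). v * ?x ^ i) ` (G \<times> {..<?D})"
  define c where "c = a * ?b"
  have b: "?b \<in> polys_in V" "?b \<noteq> 0" using p by (auto simp: coeffs_in_def)
  have c: "c \<in> polys_in V" "c \<noteq> 0" using a b by (auto simp: c_def)
  have n: "polys_in V \<subseteq> polys n" using polys_in_mono[OF V] by (simp add: polys_eq)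
  have x: "?x \<in> polys n" using J by (simp add: polys_eq)
  have fG': "finite G'" using G by (simp add: G'_def)
  let ?M = "generated V P c G'"
  have mono: "v * ?x ^ i \<in> ?M" if v: "v \<in> G" for v i
  proof (induction i rule: less_induct)
    case (less i)
    show ?case
    proof (cases "i < ?D")
      case True
      then show ?thesis using v fG' by (intro generated_base[OF P] lspan_base) (auto simp: G'_def)
    next
      case False
      \<comment> \<open>The lower terms of \<open>x ^ (i - D) * p(x)\<close> moved to the other
        side. The factor \<open>a\<close> appears because one power of the denominator
        \<open>c\<close> is \<open>a\<close> times the leading coefficient.\<close>
      let ?h = "\<Sum>e<?D. (- (a * coeff p e)) * (v * ?x ^ (i - ?D + e))"
      have "?h \<in> ?M"
      proof (rule generated_sum[OF P V c(1)])
        fix e assume "e \<in> {..<?D}"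
        then have "v * ?x ^ (i - ?D + e) \<in> ?M" using False by (intro less.IH) auto
        moreover have "- (a * coeff p e) \<in> polys_in V" using a p(1) by (simp add: coeffs_in_def)
        ultimately show "(- (a * coeff p e)) * (v * ?x ^ (i - ?D + e)) \<in> ?M"
          using generated_mult[OF P V] by blast
      qed
      moreover have "c ^ 1 * (v * ?x ^ i) - ?h = a * v * ?x ^ (i - ?D) * poly p ?x"
      proof -
        have "poly p ?x = (\<Sum>e<?D. coeff p e * ?x ^ e) + ?b * ?x ^ ?D"
          unfolding poly_altdef lessThan_Suc_atMost[symmetric] by simp
        moreover have "?x ^ i = ?x ^ (i - ?D) * ?x ^ ?D" using False by (simp flip: power_add)
        ultimately show ?thesis
          by (simp add: c_def algebra_simps sum_distrib_left power_add sum_negf)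
      qed
      moreover have "a * v * ?x ^ (i - ?D) \<in> polys n"
      proof -
        have "a \<in> polys n" "v \<in> polys n" using a n v G by auto
        then show ?thesis using x by (simp add: polys_eq)
      qed
      ultimately show ?thesis
        using generated_cong[OF P V c(1), of ?h G' 1 "v * ?x ^ i"] ideal_mult[OF P p(2)] by simp
    qed
  qed
  have tm: "g * ?x ^ i \<in> ?M" if g: "g \<in> polys_in (V \<union> J)" for g i
  proof -
    obtain k s where k: "s \<in> lspan V G" "a ^ k * g - s \<in> P" using gen g by (auto simp: generated_def)
    then obtain e where e: "s = (\<Sum>v\<in>G. e v * v)" "\<forall>v\<in>G. e v \<in> polys_in V" by (auto simp: lspan_def)
    have "(\<Sum>v\<in>G. e v * (v * ?x ^ i)) \<in> ?M"
      by (rule generated_sum[OF P V c(1)], rule generated_mult[OF P V]) (use e mono in auto)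
    \<comment> \<open>The leading coefficient to the power \<open>k\<close> turns the denominator
      \<open>a ^ k\<close> into \<open>c ^ k\<close>.\<close>
    then have h: "?b ^ k * (\<Sum>v\<in>G. e v * (v * ?x ^ i)) \<in> ?M"
      using b by (intro generated_mult[OF P V]) auto
    have "c ^ k * (g * ?x ^ i) - ?b ^ k * (\<Sum>v\<in>G. e v * (v * ?x ^ i)) =
        (?b ^ k * ?x ^ i) * (a ^ k * g - s)"
      by (simp add: e(1) c_def power_mult_distrib algebra_simps sum_distrib_left)
    moreover have "?b ^ k * ?x ^ i \<in> polys n"
    proof -
      have "?b \<in> polys n" using b n by auto
      then show ?thesis using x by (simp add: polys_eq)
    qed
    then have "(?b ^ k * ?x ^ i) * (a ^ k * g - s) \<in> P" by (rule ideal_mult[OF P k(2)])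
    ultimately have "c ^ k * (g * ?x ^ i) - ?b ^ k * (\<Sum>v\<in>G. e v * (v * ?x ^ i)) \<in> P" by simp
    then show ?thesis by (rule generated_cong[OF P V c(1) h])
  qed
  have "polys_in (V \<union> insert j J) \<subseteq> ?M"
  proof
    fix g :: "'k mpoly" assume "g \<in> polys_in (V \<union> insert j J)"
    then have "g \<in> polys_in (insert j (V \<union> J))" by simp
    then obtain r where r: "coeffs_in (V \<union> J) r" "poly r ?x = g" by (rule polys_in_insert)
    have "(\<Sum>i\<le>degree r. coeff r i * ?x ^ i) \<in> ?M"
      using r by (intro generated_sum[OF P V c(1)] tm) (auto simp: coeffs_in_def)
    then show "g \<in> ?M" using r by (simp add: poly_altdef)
  qed
  moreover have "G' \<subseteq> polys n" using G x by (auto simp: G'_def polys_eq)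
  ultimately show ?thesis using fG' c by blast
qed

text \<open>The variables outside \<open>V\<close> are adjoined one at a time; each is algebraic
  over \<open>K[V]\<close> modulo \<open>P\<close>, so each costs one more factor in the
  denominator.\<close>

lemma finitely_generated:
  fixes P :: "'k::idom mpoly set"
  assumes P: "is_ideal n P" and V: "V \<subseteq> {..<n}" "indep V P"
    and alg: "\<And>j. j < n \<Longrightarrow> j \<notin> V \<Longrightarrow> \<not> indep (insert j V) P"
  obtains G a where "finite G" "G \<subseteq> polys n" "a \<in> polys_in V" "a \<noteq> 0" "polys n \<subseteq> generated V P a G"
proof -
  have "\<exists>G a. finite G \<and> G \<subseteq> polys n \<and> a \<in> polys_in V \<and> a \<noteq> 0 \<and> polys_in (V \<union> J) \<subseteq> generated V P a G"
    if "finite J" "J \<subseteq> {..<n} - V" for J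
    using that
  proof (induction rule: finite_induct)
    case empty
    have "g \<in> lspan V {1}" if "g \<in> polys_in V" for g
      using that unfolding lspan_def by (intro CollectI exI[of _ "\<lambda>_. g"]) auto
    then have "polys_in V \<subseteq> generated V P 1 {1}" using generated_base[OF P] by blast
    then show ?case by (intro exI[of _ "{1}"] exI[of _ 1]) (auto simp: polys_eq)
  next
    case (insert j J)
    then obtain G a where G: "finite G" "G \<subseteq> polys n" "a \<in> polys_in V" "a \<noteq> 0"
      "polys_in (V \<union> J) \<subseteq> generated V P a G" by auto
    obtain p where "coeffs_in V p" "poly p (Var j) \<in> P" "degree p > 0"
      using dependent_poly[OF alg V(2)] insert.prems by auto
    then show ?case using insert.prems by (intro finitely_generated_step[OF P V(1) _ G]) auto
  qed
  from this[of "{..<n} - V"] have "\<exists>G a. finite G \<and> G \<subseteq> polys n \<and> a \<in> polys_in V \<and> a \<noteq> 0 \<and>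
     polys n \<subseteq> generated V P a G"
    using V(1) by (simp add: Un_absorb1 polys_eq)
  then show ?thesis using that by blast
qed

text \<open>Nakayama's lemma over the local ring of \<open>K[W]\<close> at \<open>y\<close>, with
  the units written as polynomials that do not vanish at \<open>y\<close>: a finitely generated
  module equal to \<open>f\<close> times itself, with \<open>f\<close> in the maximal ideal, is 0.
  The generators are eliminated one by one.\<close>

lemma nakayama:
  fixes P :: "'k::field mpoly set"
  assumes P: "is_ideal n P" and W: "W \<subseteq> {..<n}" and f: "f \<in> polys_in W" "eval y f = 0"
    and "finite G" "G \<subseteq> polys n"
    and "\<And>v. v \<in> G \<Longrightarrow> \<exists>t\<in>polys_in W. eval y t \<noteq> 0 \<and> (\<exists>s\<in>lspan W G. t * v - f * s \<in> P)"
  shows "\<exists>t\<in>polys_in W. eval y t \<noteq> 0 \<and> (\<forall>v\<in>G. t * v \<in> P)"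
  using assms(5-)
proof (induction G rule: finite_induct)
  case empty
  show ?case by (intro bexI[of _ 1]) auto
next
  case (insert v G)
  have n: "g \<in> polys n" if "g \<in> polys_in W" for g using polys_in_mono[OF W] that by (auto simp: polys_eq)
  have split: "\<exists>c s'. c \<in> polys_in W \<and> s' \<in> lspan W G \<and> s = c * v + s'" if "s \<in> lspan W (insert v G)" for s
    using that insert.hyps by (auto simp: lspan_def)
  obtain t s where t: "t \<in> polys_in W" "eval y t \<noteq> 0" "s \<in> lspan W (insert v G)" "t * v - f * s \<in> P"
    using insert.prems(2)[of v] by blast
  obtain c s' where s: "c \<in> polys_in W" "s' \<in> lspan W G" "s = c * v + s'" using split t by blast
  \<comment> \<open>The relation \<open>t * v = f * (c * v + s')\<close> modulo \<open>P\<close> is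
    solved for \<open>v\<close>. Since \<open>f\<close> is 0 at \<open>y\<close>, the coefficient
    \<open>t - f * c\<close> has the same nonzero value there as \<open>t\<close>.\<close>
  define t1 where "t1 = t - f * c"
  have t1: "t1 \<in> polys_in W" "eval y t1 \<noteq> 0" using t s f by (auto simp: t1_def)
  have v: "t1 * v - f * s' \<in> P" using t s by (simp add: t1_def algebra_simps)
  have "\<exists>t\<in>polys_in W. eval y t \<noteq> 0 \<and> (\<exists>s\<in>lspan W G. t * u - f * s \<in> P)" if u: "u \<in> G" for u
  proof -
    obtain t2 s2 where t2: "t2 \<in> polys_in W" "eval y t2 \<noteq> 0" "s2 \<in> lspan W (insert v G)" "t2 * u - f * s2 \<in> P"
      using insert.prems(2)[of u] u by blast
    obtain c2 s2' where s2: "c2 \<in> polys_in W" "s2' \<in> lspan W G" "s2 = c2 * v + s2'" using split t2 by blast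
    \<comment> \<open>Multiplication by \<open>t1\<close> allows the occurrence of \<open>v\<close>
      in the relation for \<open>u\<close> to be replaced by \<open>f * s'\<close>, which involves
      only \<open>G\<close>.\<close>
    have "t1 * (t2 * u - f * s2) + (f * c2) * (t1 * v - f * s') \<in> P"
      using t1 t2 s2 f v by (intro ideal_add[OF P] ideal_mult[OF P] n) auto
    then have "(t1 * t2) * u - f * (t1 * s2' + (f * c2) * s') \<in> P"
      by (simp add: s2 algebra_simps)
    moreover have "t1 * s2' + (f * c2) * s' \<in> lspan W G"
      using s s2 f t1 by (intro lspan_add lspan_mult) auto
    ultimately show ?thesis using t1 t2 by (intro bexI[of _ "t1 * t2"]) auto
  qed
  then obtain t3 where t3: "t3 \<in> polys_in W" "eval y t3 \<noteq> 0" "\<forall>u\<in>G. t3 * u \<in> P"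
    using insert.IH insert.prems by auto
  obtain e where e: "s' = (\<Sum>u\<in>G. e u * u)" "\<forall>u\<in>G. e u \<in> polys_in W" using s by (auto simp: lspan_def)
  have "t3 * s' = (\<Sum>u\<in>G. e u * (t3 * u))" by (simp add: e sum_distrib_left ac_simps)
  also have "\<dots> \<in> P"
    by (rule ideal_sum[OF P], rule ideal_mult[OF P]) (use e t3 n in auto)
  finally have "t3 * s' \<in> P" .
  then have "t3 * (t1 * v - f * s') + f * (t3 * s') \<in> P"
    using ideal_add[OF P ideal_mult[OF P v n[OF t3(1)]] ideal_mult[OF P _ n[OF f(1)]]] by blast
  then have "(t1 * t3) * v \<in> P" by (simp add: algebra_simps)
  moreover have "(t1 * t3) * u \<in> P" if "u \<in> G" for u
    using ideal_mult[OF P _ n[OF t1(1)], of "t3 * u"] t3 that by (simp add: mult.assoc)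
  ultimately show ?case using t1 t3 by (intro bexI[of _ "t1 * t3"]) auto
qed

lemma prime_ideal_avoiding_nonzero:
  fixes J :: "'k::idom mpoly set"
  assumes "is_ideal n J" "J \<inter> (polys_in V - {0}) = {}"
  obtains P where "is_prime_ideal n P" "J \<subseteq> P" "P \<inter> (polys_in V - {0}) = {}"
proof -
  have "s * t \<in> polys_in V - {0}" if "s \<in> polys_in V - {0}" "t \<in> polys_in V - {0}" for s t :: "'k mpoly"
    using that by auto
  moreover have "(1::'k mpoly) \<in> polys_in V - {0}" by simp
  ultimately show ?thesis using prime_ideal_avoiding[OF assms(1) _ _ assms(2)] that by blast
qed

text \<open>The new prime contains \<open>x\<^sub>v - c\<close>, where \<open>c\<close> is the \<open>v\<close>-coordinate of a point outside the zero set of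
  the denominator \<open>a\<close>; Nakayama's lemma shows that \<open>P + (x\<^sub>v - c)\<close> contains no nonzero polynomial in the
  remaining variables.\<close>

lemma prime_step:
  fixes P :: "'k::field_char_0 mpoly set"
  assumes P: "is_prime_ideal n P" and V: "V \<subseteq> {..<n}" "indep V P" "v \<in> V"
  obtains P' where "is_prime_ideal n P'" "P \<subset> P'" "indep (V - {v}) P'"
proof -
  have PI: "is_ideal n P" using P by (simp add: is_prime_ideal_def)
  \<comment> \<open>Finite generation requires every remaining variable to be algebraic, so
    \<open>V\<close> is first enlarged to a maximal independent set \<open>W\<close>.\<close>
  let ?\<W> = "{W. V \<subseteq> W \<and> W \<subseteq> {..<n} \<and> indep W P}"
  have "finite ?\<W>" by (rule finite_subset[of _ "Pow {..<n}"]) auto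
  moreover have "V \<in> ?\<W>" using V by simp
  ultimately obtain W where W: "W \<in> ?\<W>" "\<And>U. U \<in> ?\<W> \<Longrightarrow> W \<subseteq> U \<Longrightarrow> U = W"
    by (metis (no_types, lifting) empty_iff finite_has_maximal)
  have "\<not> indep (insert j W) P" if "j < n" "j \<notin> W" for j
    using W(2)[of "insert j W"] W(1) that by auto
  then obtain G a where G: "finite G" "G \<subseteq> polys n" and a: "a \<in> polys_in W" "a \<noteq> 0"
    and gen: "polys n \<subseteq> generated W P a G"
    using finitely_generated[OF PI, of W] W(1) by blast
  have Wn: "W \<subseteq> {..<n}" and iW: "indep W P" and vW: "v \<in> W" using W(1) V by auto
  have n: "g \<in> polys n" if "g \<in> polys_in W" for g using polys_in_mono[OF Wn] that by (auto simp: polys_eq)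
  obtain y where y: "eval y a \<noteq> 0"
    using ex_nonvanishing_point[OF _ a] Wn finite_subset[OF Wn] by auto
  define f :: "'k mpoly" where "f = Var v - Const (y v)"
  have fV: "f \<in> polys_in V" using V by (simp add: f_def)
  then have fW: "f \<in> polys_in W" using polys_in_mono[of V W] W(1) by auto
  let ?S = "polys_in (V - {v}) - {0}"
  have "ideal_plus n P f \<inter> ?S = {}"
  proof (rule ccontr)
    assume "\<not> ?thesis"
    then obtain s m r where s: "s \<in> polys_in (V - {v})" "s \<noteq> 0" "s = m + r * f" "m \<in> P" "r \<in> polys n"
      by (auto simp: ideal_plus_def)
    \<comment> \<open>\<open>s\<close> does not involve \<open>Var v\<close>, so \<open>z\<close>
      can be moved into the hyperplane where \<open>f\<close> vanishes, which also contains
      \<open>y\<close>. The line joining them stays in the hyperplane, and some point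
      \<open>x\<close> on it avoids the zeros of both \<open>a\<close> and \<open>s\<close>.\<close>
    obtain z where z: "eval z s \<noteq> 0"
      using ex_nonvanishing_point[OF _ s(1,2)] V finite_subset[OF V(1)] by auto
    define z' where "z' = z(v := y v)"
    have "eval z' s \<noteq> 0"
      using z eval_cong[OF s(1), of z z'] by (simp add: z'_def)
    from ex_common_nonvanishing_on_line[OF y this]
    obtain l where l: "eval (\<lambda>i. y i + l * (z' i - y i)) a \<noteq> 0" "eval (\<lambda>i. y i + l * (z' i - y i)) s \<noteq> 0"
      by blast
    define x where "x = (\<lambda>i. y i + l * (z' i - y i))"
    have x: "eval x a \<noteq> 0" "eval x s \<noteq> 0" "eval x f = 0"
      using l by (simp_all add: x_def f_def z'_def)
    have sW: "s \<in> polys_in W" using polys_in_mono[of "V - {v}" W] W(1) s by auto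
    \<comment> \<open>Modulo \<open>P\<close>, multiplication by \<open>s\<close> equals
      multiplication by \<open>f * r\<close>. After a power of \<open>a\<close> has cleared the
      denominator of \<open>r * u\<close>, the coefficient of \<open>u\<close> is
      \<open>a ^ k * s\<close>, nonzero at \<open>x\<close>.\<close>
    have "\<exists>t\<in>polys_in W. eval x t \<noteq> 0 \<and> (\<exists>s\<in>lspan W G. t * u - f * s \<in> P)" if u: "u \<in> G" for u
    proof -
      have "r * u \<in> polys n" using s u G by (auto simp: polys_eq)
      then obtain k q where q: "q \<in> lspan W G" "a ^ k * (r * u) - q \<in> P"
        using gen by (auto simp: generated_def)
      have "a ^ k * u * m + f * (a ^ k * (r * u) - q) \<in> P"
        using q s u G a fW by (intro ideal_add[OF PI] ideal_mult[OF PI]) (auto simp: n polys_eq n[unfolded polys_eq])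
      then have "(a ^ k * s) * u - f * q \<in> P" by (simp add: s(3) algebra_simps)
      then show ?thesis using q a sW x by (intro bexI[of _ "a ^ k * s"]) auto
    qed
    from nakayama[OF PI Wn fW x(3) G this] obtain t where
      t: "t \<in> polys_in W" "eval x t \<noteq> 0" "\<forall>u\<in>G. t * u \<in> P" by blast
    \<comment> \<open>\<open>t\<close> kills all generators modulo \<open>P\<close>, hence also a
      power of \<open>a\<close>. Then \<open>t * a ^ k\<close> is an element of \<open>K[W]\<close>
      in \<open>P\<close> that is nonzero at \<open>x\<close>, against the independence of
      \<open>W\<close>.\<close>
    have "1 \<in> polys n" by (simp add: polys_eq)
    then obtain k q where q: "q \<in> lspan W G" "a ^ k * 1 - q \<in> P" using gen by (auto simp: generated_def)
    then obtain e where e: "q = (\<Sum>u\<in>G. e u * u)" "\<forall>u\<in>G. e u \<in> polys_in W" by (auto simp: lspan_def)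
    have "t * q = (\<Sum>u\<in>G. e u * (t * u))" by (simp add: e sum_distrib_left ac_simps)
    also have "\<dots> \<in> P"
      by (rule ideal_sum[OF PI], rule ideal_mult[OF PI]) (use e t n in auto)
    finally have "t * q \<in> P" .
    then have "t * (a ^ k * 1 - q) + t * q \<in> P"
      using ideal_add[OF PI ideal_mult[OF PI q(2) n[OF t(1)]]] by blast
    then have "t * a ^ k \<in> P" by (simp add: algebra_simps)
    moreover have "t * a ^ k \<in> polys_in W" using t a by simp
    ultimately have "t * a ^ k = 0" using iW unfolding indep_def by blast
    then have "eval x (t * a ^ k) = 0" by (simp only: eval_zero)
    then show False using t x by simp
  qed
  then obtain P' where P': "is_prime_ideal n P'" "ideal_plus n P f \<subseteq> P'" "P' \<inter> ?S = {}"
    using prime_ideal_avoiding_nonzero[OF ideal_plus_ideal[OF PI n[OF fW]]] by blast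
  have "f \<noteq> 0"
  proof
    assume "f = 0"
    then have "eval (\<lambda>_. y v + 1) f = 0" by simp
    then show False by (simp add: f_def)
  qed
  then have "f \<notin> P" using fV V by (auto simp: indep_def)
  then have "P \<subset> P'" using P' ideal_plus_mem[OF PI] ideal_plus_subset by blast
  moreover have "indep (V - {v}) P'" using P'(3) by (auto simp: indep_def)
  ultimately show ?thesis using that P' by blast
qed

section \<open>Bounds on independent sets from the dimension\<close>

lemma prime_chain_Cons:
  assumes "is_prime_ideal n P" "P \<subset> P'" "prime_chain n P' l C" "C 0 = P'"
  shows "prime_chain n P (Suc l) (case_nat P C)"
  using assms unfolding prime_chain_def by (auto split: nat.splits)

text \<open>Each application of \<open>prime_step\<close> gives up one variable of \<open>V\<close>
  for one strict inclusion. This bounds the size of independent sets by the dimension.\<close>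

lemma ex_prime_chain:
  fixes P :: "'k::field_char_0 mpoly set"
  assumes "finite V" "V \<subseteq> {..<n}" "is_prime_ideal n P" "indep V P"
  shows "\<exists>C. prime_chain n P (card V) C \<and> C 0 = P"
  using assms
proof (induction V arbitrary: P rule: finite_induct)
  case empty
  then show ?case by (intro exI[of _ "\<lambda>_. P"]) (auto simp: prime_chain_def)
next
  case (insert v V)
  obtain P' where P': "is_prime_ideal n P'" "P \<subset> P'" "indep (insert v V - {v}) P'"
    using prime_step[of n P "insert v V" v] insert.prems by blast
  then obtain C where "prime_chain n P' (card V) C" "C 0 = P'"
    using insert by auto
  then have "prime_chain n P (Suc (card V)) (case_nat P C)"
    using prime_chain_Cons insert.prems P' by blast
  then show ?case using insert by (intro exI[of _ "case_nat P C"]) auto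
qed

lemma indep_card_le_dim:
  fixes P :: "'k::field_char_0 mpoly set"
  assumes "ideal_dim n I d" "I \<subseteq> P" "is_prime_ideal n P" "V \<subseteq> {..<n}" "indep V P"
  shows "card V \<le> d"
proof -
  obtain C where C: "prime_chain n P (card V) C"
    using ex_prime_chain[of V n P] assms finite_subset[OF assms(4)] by auto
  then have "prime_chain n I (card V) C" using assms(2) by (auto simp: prime_chain_def)
  then show ?thesis using assms(1) by (auto simp: ideal_dim_def)
qed

lemma indep_card_less_dim:
  fixes P :: "'k::field_char_0 mpoly set"
  assumes "ideal_dim n I d" "I \<subseteq> P" "is_prime_ideal n P" "V \<subseteq> {..<n}" "indep V P'"
    and "is_prime_ideal n P'" "P \<subset> P'"
  shows "card V < d"
proof -
  obtain C where "prime_chain n P' (card V) C" "C 0 = P'"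
    using ex_prime_chain[of V n P'] assms finite_subset[OF assms(4)] by auto
  then have "prime_chain n P (Suc (card V)) (case_nat P C)"
    using prime_chain_Cons assms by blast
  then have "prime_chain n I (Suc (card V)) (case_nat P C)" using assms(2) by (auto simp: prime_chain_def)
  then have "Suc (card V) \<le> d" using assms(1) by (auto simp: ideal_dim_def)
  then show ?thesis by simp
qed

text \<open>Otherwise some prime strictly above \<open>P\<close> would still have \<open>t\<close> independent, giving a chain of length \<open>d + 1\<close>.\<close>

lemma invertible_mod_prime:
  fixes P :: "'k::field_char_0 mpoly set"
  assumes dim: "ideal_dim n I d" "I \<subseteq> P" and P: "is_prime_ideal n P" and "d \<le> n" and f: "f \<in> polys n" "f \<notin> P"
  obtains r b where "r \<in> polys n" "b \<in> polys_in {..<d}" "b \<noteq> 0" "r * f - b \<in> P"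
proof -
  have PI: "is_ideal n P" using P by (simp add: is_prime_ideal_def)
  let ?S = "polys_in {..<d} - {0} :: 'k mpoly set"
  have "ideal_plus n P f \<inter> ?S \<noteq> {}"
  proof
    assume "ideal_plus n P f \<inter> ?S = {}"
    then obtain P' where P': "is_prime_ideal n P'" "ideal_plus n P f \<subseteq> P'" "P' \<inter> ?S = {}"
      using prime_ideal_avoiding_nonzero[OF ideal_plus_ideal[OF PI f(1)]] by blast
    then have "P \<subset> P'" using ideal_plus_mem[OF PI] ideal_plus_subset f by blast
    moreover have "indep {..<d} P'" using P'(3) by (auto simp: indep_def)
    ultimately show False
      using indep_card_less_dim[OF dim P, of "{..<d}" P'] P'(1) \<open>d \<le> n\<close> by auto
  qed
  then obtain m r where r: "m \<in> P" "r \<in> polys n" "m + r * f \<in> polys_in {..<d}" "m + r * f \<noteq> 0"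
    by (auto simp: ideal_plus_def)
  have "r * f - (m + r * f) \<in> P" using ideal_uminus[OF PI r(1)] by simp
  then show ?thesis using that r by blast
qed

section \<open>Fibres\<close>

text \<open>The ideal \<open>J + (t - t_0)\<close> with \<open>t_0\<close> the first
  \<open>d\<close> coordinates of \<open>q\<close>, in explicit form, so that membership yields
  cofactors \<open>u l\<close> directly.\<close>

definition fiber :: "nat \<Rightarrow> nat \<Rightarrow> ('k::comm_ring_1) mpoly set \<Rightarrow> (nat \<Rightarrow> 'k) \<Rightarrow> 'k mpoly set" where
  "fiber n d J q = {m + (\<Sum>l<d. (Var l - Const (q l)) * u l) | m u. m \<in> J \<and> (\<forall>l. u l \<in> polys n)}"

lemma fiberI:
  "m \<in> J \<Longrightarrow> (\<And>l. u l \<in> polys n) \<Longrightarrow> m + (\<Sum>l<d. (Var l - Const (q l)) * u l) \<in> fiber n d J q"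
  unfolding fiber_def by blast

lemma fiber_ideal:
  assumes J: "is_ideal n J" and "d \<le> n"
  shows "is_ideal n (fiber n d J q)"
  unfolding is_ideal_def
proof (intro conjI ballI)
  show "fiber n d J q \<subseteq> polys n"
  proof
    fix f assume "f \<in> fiber n d J q"
    then obtain m u where f: "f = m + (\<Sum>l<d. (Var l - Const (q l)) * u l)" "m \<in> J" "\<forall>l. u l \<in> polys n"
      by (auto simp: fiber_def)
    have "m \<in> polys n" using ideal_subset[OF J f(2)] .
    moreover have "(\<Sum>l<d. (Var l - Const (q l)) * u l) \<in> polys n"
      using f(3) \<open>d \<le> n\<close> unfolding polys_eq by (intro polys_in_sum polys_in_mult polys_in_diff) auto
    ultimately show "f \<in> polys n" by (simp add: f(1) polys_eq)
  qed
  show "0 \<in> fiber n d J q"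
    using fiberI[where m=0 and J=J and u="\<lambda>_. 0" and n=n and d=d and q=q] ideal_0[OF J]
    by (simp add: polys_eq)
  fix f assume "f \<in> fiber n d J q"
  then obtain m u where f: "f = m + (\<Sum>l<d. (Var l - Const (q l)) * u l)" "m \<in> J" "\<forall>l. u l \<in> polys n"
    by (auto simp: fiber_def)
  {
    fix g assume "g \<in> fiber n d J q"
    then obtain m' u' where g: "g = m' + (\<Sum>l<d. (Var l - Const (q l)) * u' l)" "m' \<in> J" "\<forall>l. u' l \<in> polys n"
      by (auto simp: fiber_def)
    have "f + g = (m + m') + (\<Sum>l<d. (Var l - Const (q l)) * (u l + u' l))"
      by (simp add: f(1) g(1) distrib_left sum.distrib)
    also have "\<dots> \<in> fiber n d J q"
      by (rule fiberI, rule ideal_add[OF J f(2) g(2)]) (use f g in \<open>simp add: polys_eq\<close>)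
    finally show "f + g \<in> fiber n d J q" .
  }
  fix r :: "'a mpoly" assume r: "r \<in> polys n"
  have "r * f = r * m + (\<Sum>l<d. (Var l - Const (q l)) * (r * u l))"
    by (simp add: f(1) distrib_left sum_distrib_left mult.left_commute)
  also have "\<dots> \<in> fiber n d J q"
    by (rule fiberI, rule ideal_mult[OF J f(2) r]) (use f r in \<open>simp add: polys_eq\<close>)
  finally show "r * f \<in> fiber n d J q" .
qed

lemma fiber_superset: "J \<subseteq> fiber n d J q"
  using fiberI[where J=J and u="\<lambda>_. 0" and n=n and d=d and q=q] by (auto simp: polys_eq)

lemma fiber_Var:
  assumes "is_ideal n J" "l < d"
  shows "Var l - Const (q l) \<in> fiber n d J q"
proof -
  have "0 + (\<Sum>k<d. (Var k - Const (q k)) * (if k = l then 1 else 0)) \<in> fiber n d J q"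
    using assms by (intro fiberI) (auto simp: ideal_0 polys_eq)
  also have "(\<Sum>k<d. (Var k - Const (q k)) * (if k = l then 1 else 0)) =
     (\<Sum>k<d. if k = l then Var k - Const (q k) else 0)"
    by (rule sum.cong) auto
  also have "\<dots> = Var l - Const (q l)" using assms by (simp add: sum.delta)
  finally show ?thesis by simp
qed

text \<open>On the fibre every polynomial in \<open>t\<close> is a constant; a denominator that is
  nonzero at \<open>q\<close> is therefore a unit there.\<close>

lemma fiber_eval:
  assumes J: "is_ideal n J" "d \<le> n" and "b \<in> polys_in {..<d}"
  shows "b - Const (eval q b) \<in> fiber n d J q"
  using assms(3)
proof (induction b rule: polys_in_induct)
  case (const c)
  then show ?case using ideal_0[OF fiber_ideal[OF J]] by simp
next
  case (add f g)
  then show ?case using ideal_add[OF fiber_ideal[OF J] add(3,4)] by (simp add: Const_add algebra_simps)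
next
  case (var b i)
  have "b \<in> polys n" using var polys_in_mono[of "{..<d}" "{..<n}"] J(2) by (auto simp: polys_eq)
  then have "b * (Var i - Const (q i)) + Const (q i) * (b - Const (eval q b)) \<in> fiber n d J q"
    using var by (intro ideal_add[OF fiber_ideal[OF J]] ideal_mult[OF fiber_ideal[OF J]] fiber_Var[OF J(1)])
      (auto simp: polys_eq)
  then show ?case by (simp add: Const_mult algebra_simps)
qed

section \<open>Vanishing on a fibre with split coordinate equations\<close>

lemma ideal_Const_cancel:
  fixes J :: "'k::field mpoly set"
  assumes "is_ideal n J" "c \<noteq> 0" "Const c * g \<in> J"
  shows "g \<in> J"
proof -
  have "Const (inverse c) * (Const c * g) \<in> J"
    by (rule ideal_mult[OF assms(1,3)]) (simp add: polys_eq)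
  then show ?thesis using assms(2) by (simp add: mult.assoc[symmetric] Const_mult[symmetric])
qed

text \<open>Lagrange interpolation: the products of \<open>x - a\<close> over \<open>S\<close> with
  one element omitted generate the unit ideal.\<close>

lemma ideal_prod_roots_cancel:
  fixes J :: "'k::field mpoly set"
  assumes J: "is_ideal n J" and x: "x \<in> polys n" and "finite S" "S \<noteq> {}"
    and "g \<in> polys n" "\<And>c. c \<in> S \<Longrightarrow> (\<Prod>a\<in>S - {c}. x - Const a) * g \<in> J"
  shows "g \<in> J"
  using assms(3-)
proof (induction S arbitrary: g rule: finite_ne_induct)
  case (singleton c)
  then show ?case by simp
next
  case (insert c S)
  let ?y = "x - Const c"
  have yg: "?y * g \<in> J"
  proof (rule insert.IH)
    show "?y * g \<in> polys n" using x insert.prems by (simp add: polys_eq)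
    fix a assume a: "a \<in> S"
    then have "insert c S - {a} = insert c (S - {a})" using insert.hyps by auto
    then show "(\<Prod>e\<in>S - {a}. x - Const e) * (?y * g) \<in> J"
      using insert.prems(2)[of a] a insert.hyps by (simp add: ac_simps)
  qed
  \<comment> \<open>As \<open>(x - Const c) * g\<close> lies in \<open>J\<close>, \<open>x\<close>
    acts on \<open>g\<close> as the constant \<open>c\<close> modulo \<open>J\<close>.\<close>
  have "(\<Prod>a\<in>X. x - Const a) * g - Const (\<Prod>a\<in>X. c - a) * g \<in> J" if "finite X" for X
    using that
  proof (induction rule: finite_induct)
    case empty
    then show ?case using ideal_0[OF J] by simp
  next
    case (insert a X)
    have px: "(\<Prod>a\<in>X. x - Const a) \<in> polys n" using x by (auto simp: polys_eq)
    have "(\<Prod>a\<in>X. x - Const a) * (?y * g) + Const (c - a) *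
       ((\<Prod>a\<in>X. x - Const a) * g - Const (\<Prod>a\<in>X. c - a) * g) \<in> J"
      by (rule ideal_add[OF J ideal_mult[OF J yg px] ideal_mult[OF J insert.IH]]) (simp add: polys_eq)
    then show ?case using insert by (simp add: Const_mult Const_diff algebra_simps)
  qed
  from this[OF insert.hyps(1)] have "(\<Prod>a\<in>S. x - Const a) * g - Const (\<Prod>a\<in>S. c - a) * g \<in> J" .
  moreover have "insert c S - {c} = S" using insert.hyps by auto
  then have "(\<Prod>a\<in>S. x - Const a) * g \<in> J" using insert.prems(2)[of c] by simp
  ultimately have "Const (\<Prod>a\<in>S. c - a) * g \<in> J" using ideal_eq_iff_diff[OF J] by blast
  moreover have "(\<Prod>a\<in>S. c - a) \<noteq> 0" using insert.hyps by auto
  ultimately show ?case using ideal_Const_cancel[OF J] by blast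
qed

text \<open>If \<open>f\<close> were not in \<open>J\<close>, a common eigenvector \<open>u\<close>
  of all coordinates modulo \<open>J\<close> with \<open>u * f\<close> outside \<open>J\<close>
  could be built. Its eigenvalues form a point at which every \<open>r\<close> in \<open>J\<close>
  vanishes, since \<open>r\<close> acts on \<open>u\<close> as its value there and \<open>u\<close>
  is not in \<open>J\<close>. But \<open>f\<close> vanishes at that point, so \<open>f * u\<close>
  is in \<open>J\<close>.\<close>

lemma mem_if_vanishes_on_variety:
  fixes J :: "'k::field mpoly set"
  assumes J: "is_ideal n J"
    and S: "\<And>j. j < n \<Longrightarrow> \<exists>S. finite S \<and> (\<Prod>c\<in>S. Var j - Const c) \<in> J"
    and f: "f \<in> polys n" "\<And>q. q \<in> variety n J \<Longrightarrow> eval q f = 0"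
  shows "f \<in> J"
proof (rule ccontr)
  assume nf: "f \<notin> J"
  \<comment> \<open>The eigenvector is refined one coordinate at a time: interpolation shows that
    one of the products with a root omitted keeps \<open>u * f\<close> outside \<open>J\<close>, and
    multiplication by it makes the omitted root the eigenvalue.\<close>
  have "\<exists>q u. u \<in> polys n \<and> u * f \<notin> J \<and> (\<forall>j<k. (Var j - Const (q j)) * u \<in> J)" if "k \<le> n" for k
    using that
  proof (induction k)
    case 0
    then show ?case using nf by (intro exI[of _ undefined] exI[of _ 1]) (auto simp: polys_eq)
  next
    case (Suc k)
    then obtain q u where u: "u \<in> polys n" "u * f \<notin> J" "\<And>j. j < k \<Longrightarrow> (Var j - Const (q j)) * u \<in> J"
      by auto
    obtain S where S: "finite S" "(\<Prod>c\<in>S. Var k - Const c) \<in> J" using S[of k] Suc.prems by auto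
    let ?x = "Var k :: 'k mpoly"
    have x: "?x \<in> polys n" using Suc.prems by (simp add: polys_eq)
    have uf: "u * f \<in> polys n" using u f by (simp add: polys_eq)
    have "S \<noteq> {}" using S(2) ideal_mult[OF J _ uf, of 1] u(2) by auto
    then obtain c where c: "c \<in> S" "(\<Prod>a\<in>S - {c}. ?x - Const a) * (u * f) \<notin> J"
      using ideal_prod_roots_cancel[OF J x S(1) _ uf] u(2) by blast
    let ?p = "\<Prod>a\<in>S - {c}. ?x - Const a"
    have p: "?p \<in> polys n" using x by (auto simp: polys_eq)
    have "(?x - Const c) * (?p * u) \<in> J"
      using ideal_mult[OF J S(2) u(1)] prod.remove[OF S(1) c(1), of "\<lambda>c. ?x - Const c"] by (simp add: ac_simps)
    moreover have "(Var j - Const (q j)) * (?p * u) \<in> J" if "j < k" for j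
      using ideal_mult[OF J u(3)[OF that] p] by (simp add: ac_simps)
    ultimately have "\<forall>j<Suc k. (Var j - Const ((q(k := c)) j)) * (?p * u) \<in> J"
      by (auto simp: less_Suc_eq)
    moreover have "?p * u \<in> polys n" using p u by (simp add: polys_eq)
    moreover have "(?p * u) * f \<notin> J" using c(2) by (simp add: mult.assoc)
    ultimately show ?case by blast
  qed
  from this[of n] obtain q u where u: "u \<in> polys n" "u * f \<notin> J" "\<And>j. j < n \<Longrightarrow> (Var j - Const (q j)) * u \<in> J"
    by auto
  \<comment> \<open>Elements of \<open>points n\<close> are 0 from index \<open>n\<close> on, where
    \<open>q\<close> is arbitrary.\<close>
  define q' where "q' = (\<lambda>i. if i < n then q i else 0)"
  have key: "r * u - Const (eval q' r) * u \<in> J" if "r \<in> polys_in {..<n}" for r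
    using that
  proof (induction r rule: polys_in_induct)
    case (const c)
    then show ?case using ideal_0[OF J] by simp
  next
    case (add r s)
    then show ?case using ideal_add[OF J add(3,4)] by (simp add: Const_add algebra_simps)
  next
    case (var r i)
    have "r * ((Var i - Const (q i)) * u) + Const (q i) * (r * u - Const (eval q' r) * u) \<in> J"
      by (rule ideal_add[OF J ideal_mult[OF J u(3)] ideal_mult[OF J var(3)]])
        (use var in \<open>auto simp: polys_eq\<close>)
    moreover have "q' i = q i" using var by (simp add: q'_def)
    ultimately show ?case by (simp add: Const_mult algebra_simps)
  qed
  have "eval q' r = 0" if r: "r \<in> J" for r
  proof (rule ccontr)
    assume n0: "eval q' r \<noteq> 0"
    have "r * u \<in> J" using ideal_mult_right[OF J r u(1)] .
    then have "Const (eval q' r) * u \<in> J"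
      using key[of r] ideal_subset[OF J r] ideal_eq_iff_diff[OF J] by (auto simp: polys_eq)
    then have "u \<in> J" using ideal_Const_cancel[OF J n0] by blast
    then show False using u(2) ideal_mult_right[OF J _ f(1)] by blast
  qed
  then have "q' \<in> variety n J" by (simp add: variety_def points_def q'_def)
  then have "f * u \<in> J" using key[of f] f by (simp add: polys_eq)
  then show False using u(2) by (simp add: mult.commute)
qed

section \<open>Simple roots on the general fibre\<close>

lemma Const_sum: "Const (\<Sum>x\<in>A. f x) = (\<Sum>x\<in>A. Const (f x))"
  by (induction A rule: infinite_finite_induct) (auto simp: Const_add)

lemma map_poly_Const_mult: "map_poly Const (p * q) = map_poly Const p * map_poly Const q"
  by (rule poly_eqI) (simp add: coeff_map_poly coeff_mult Const_sum Const_mult)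

lemma map_poly_Const_linear: "poly (map_poly Const [:- c, 1:]) x = x - Const c"
  by (simp add: map_poly_pCons Const_uminus)

lemma poly_Const_closed: "x \<in> polys n \<Longrightarrow> poly (map_poly Const p) x \<in> polys n"
  unfolding polys_eq by (rule poly_closed[of "{}"]) (auto simp: coeffs_in_def coeff_map_poly)

text \<open>If \<open>a\<close> is a multiple root of \<open>p\<close>, then \<open>x - a\<close> divides the unit \<open>p'(x)\<close> modulo \<open>J\<close> and can be cancelled.\<close>

lemma simple_roots_mod_ideal:
  fixes p :: "'k::{alg_closed_field, field_char_0} poly"
  assumes J: "is_ideal n J" and x: "x \<in> polys n"
    and p: "poly (map_poly Const p) x \<in> J"
    and unit: "r \<in> polys n" "c \<noteq> 0" "r * poly (map_poly Const (pderiv p)) x - Const c \<in> J"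
  shows "\<exists>S. finite S \<and> (\<Prod>c\<in>S. x - Const c) \<in> J"
proof (cases "p = 0")
  case True
  \<comment> \<open>A specialized polynomial may become 0; the unit condition then forces 1 into
    \<open>J\<close>, and the empty product serves.\<close>
  then have "- Const c * 1 \<in> J" using unit(3) by simp
  then have "1 \<in> J" using ideal_Const_cancel[OF J, of "- c" 1] unit(2) by (simp add: Const_uminus)
  then show ?thesis by (intro exI[of _ "{}"]) simp
next
  case False
  then obtain A where A: "p = smult (lead_coeff p) (\<Prod>x\<in>#A. [:-x, 1:])"
    using alg_closed_imp_factorization by blast
  let ?ev = "\<lambda>p. poly (map_poly Const p) x"
  have ev_mult: "?ev (p * q) = ?ev p * ?ev q" for p q by (simp add: map_poly_Const_mult)
  have "?ev (\<Prod>x\<in>#A. [:-x, 1:]) \<in> J"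
  proof (rule ideal_Const_cancel[OF J])
    show "lead_coeff p \<noteq> 0" using False by simp
    have "?ev p = ?ev [:lead_coeff p:] * ?ev (\<Prod>x\<in>#A. [:-x, 1:])"
      by (subst A) (simp flip: ev_mult)
    then show "Const (lead_coeff p) * ?ev (\<Prod>x\<in>#A. [:-x, 1:]) \<in> J"
      using p by (simp add: map_poly_pCons)
  qed
  moreover have "\<exists>s\<in>polys n. s * (x - Const a) - 1 \<in> J" if "count A a \<ge> 2" for a
  proof -
    let ?l = "[:- a, 1:]"
    have "replicate_mset 2 a \<subseteq># A" using that by (simp add: count_le_replicate_mset_subset_eq)
    then obtain B where "A = {#a, a#} + B" by (auto simp: mset_subset_eq_exists_conv numeral_2_eq_2)
    then have "(\<Prod>x\<in>#A. [:-x, 1:]) = ?l * (?l * (\<Prod>x\<in>#B. [:-x, 1:]))" by simp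
    then have "p = ?l * (?l * smult (lead_coeff p) (\<Prod>x\<in>#B. [:-x, 1:]))"
      using A by (metis mult_smult_right)
    then obtain w where w: "p = ?l * (?l * w)" by blast
    \<comment> \<open>The derivative retains one factor \<open>x - a\<close> of the double root, so
      the hypothesis on the derivative makes \<open>x - a\<close> invertible modulo
      \<open>J\<close>.\<close>
    have "pderiv p = ?l * (w + pderiv (?l * w))"
      by (simp only: w pderiv_mult[of ?l "?l * w"]) (simp add: pderiv_pCons algebra_simps)
    then have "?ev (pderiv p) = (x - Const a) * ?ev (w + pderiv (?l * w))"
      by (simp only: ev_mult map_poly_Const_linear)
    moreover have "Const c * ((Const (inverse c) * r * ?ev (w + pderiv (?l * w))) * (x - Const a) - 1) =
       (Const c * Const (inverse c)) * (r * ((x - Const a) * ?ev (w + pderiv (?l * w)))) - Const c"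
      by (simp add: right_diff_distrib ac_simps)
    moreover have "Const c * Const (inverse c) = 1" using unit(2) by (simp flip: Const_mult)
    ultimately have "Const c * ((Const (inverse c) * r * ?ev (w + pderiv (?l * w))) * (x - Const a) - 1) \<in> J"
      using unit(3) by (simp only: mult_1_left)
    then have "(Const (inverse c) * r * ?ev (w + pderiv (?l * w))) * (x - Const a) - 1 \<in> J"
      using ideal_Const_cancel[OF J unit(2)] by blast
    moreover have "Const (inverse c) * r * ?ev (w + pderiv (?l * w)) \<in> polys n"
      using unit(1) poly_Const_closed[OF x] by (simp add: polys_eq)
    ultimately show ?thesis by blast
  qed
  \<comment> \<open>Both facts just collected, that the split polynomial lies in \<open>J\<close>
    and that its multiple roots give invertible factors, survive the removal of one copy of a
    multiple root; hence the induction on the number of roots.\<close>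
  ultimately show ?thesis
  proof (induction "size A" arbitrary: A rule: less_induct)
    case (less A)
    have evA: "?ev (\<Prod>x\<in>#A. [:-x, 1:]) = (\<Prod>a\<in>#A. x - Const a)" for A
      by (induction A) (simp_all add: ev_mult map_poly_Const_linear del: mult_pCons_left)
    show ?case
    proof (cases "\<exists>a. count A a \<ge> 2")
      case True
      then obtain a where a: "count A a \<ge> 2" by blast
      then have "a \<in># A" using count_greater_zero_iff[of A a] by linarith
      then obtain B where B: "A = add_mset a B" by (rule mset_add)
      obtain s where s: "s \<in> polys n" "s * (x - Const a) - 1 \<in> J" using less.prems(2)[OF a] by blast
      let ?b = "\<Prod>a\<in>#B. x - Const a"
      have b: "?b \<in> polys n"
        using poly_Const_closed[OF x, of "\<Prod>x\<in>#B. [:-x, 1:]"] by (simp only: evA)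
      have "(x - Const a) * ?b \<in> J" using less.prems(1) unfolding evA B by simp
      from ideal_diff[OF J ideal_mult[OF J this s(1)] ideal_mult[OF J s(2) b]]
      have "?b \<in> J" by (simp add: algebra_simps)
      then have "?ev (\<Prod>x\<in>#B. [:-x, 1:]) \<in> J" by (simp only: evA)
      moreover have "\<exists>s\<in>polys n. s * (x - Const e) - 1 \<in> J" if "count B e \<ge> 2" for e
      proof -
        have "count A e \<ge> count B e" unfolding B by simp
        then have "count A e \<ge> 2" using that by linarith
        then show ?thesis by (rule less.prems(2))
      qed
      ultimately show ?thesis using less.hyps[of B] by (simp add: B)
    next
      case False
      have "A = mset_set (set_mset A)"
      proof (rule multiset_eqI)
        fix a
        have 1: "count A a < 2" using False by (simp add: not_le)
        have 2: "m = (if Q then 1 else 0)" if "m < 2" "0 < m \<longleftrightarrow> Q" for m :: nat and Q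
          using that by (cases Q) auto
        have "count A a = (if a \<in># A then 1 else 0)" by (rule 2[OF 1 count_greater_zero_iff])
        then show "count A a = count (mset_set (set_mset A)) a" by (simp add: count_mset_set')
      qed
      then have "(\<Prod>a\<in>set_mset A. x - Const a) = (\<Prod>a\<in>#A. x - Const a)"
        by (simp add: prod_unfold_prod_mset)
      then have "(\<Prod>a\<in>set_mset A. x - Const a) \<in> J"
        using less.prems(1) by (simp only: evA)
      then show ?thesis by (intro exI[of _ "set_mset A"]) simp
    qed
  qed
qed

lemma coeffs_in_pCons: "coeffs_in V (pCons c p) \<longleftrightarrow> c \<in> polys_in V \<and> coeffs_in V p"
  unfolding coeffs_in_def coeff_pCons by (auto split: nat.splits)

lemma fiber_poly:
  assumes J: "is_ideal n J" "d \<le> n" and x: "x \<in> polys n" and "coeffs_in {..<d} p"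
  shows "poly p x - poly (map_poly Const (map_poly (eval q) p)) x \<in> fiber n d J q"
  using assms(4)
proof (induction p)
  case 0
  then show ?case using ideal_0[OF fiber_ideal[OF J]] by simp
next
  case (pCons c p)
  then have "(c - Const (eval q c)) + x * (poly p x - poly (map_poly Const (map_poly (eval q) p)) x)
      \<in> fiber n d J q"
    by (intro ideal_add[OF fiber_ideal[OF J]] ideal_mult[OF fiber_ideal[OF J]] fiber_eval[OF J] x)
      (auto simp: coeffs_in_pCons)
  then show ?case by (simp add: map_poly_pCons algebra_simps)
qed

lemma pderiv_map_poly_eval: "pderiv (map_poly (eval q) p) = map_poly (eval q) (pderiv p)"
  by (rule poly_eqI) (simp add: coeff_map_poly coeff_pderiv)

text \<open>Take a relation of least positive degree. A derivative of positive degree in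
  \<open>P\<close> would contradict minimality. A constant one in \<open>P\<close> is 0 by
  independence of \<open>V\<close>, and then \<open>p\<close> is constant because the characteristic
  is 0.\<close>

lemma separable_poly:
  fixes P :: "'k::field_char_0 mpoly set"
  assumes "\<not> indep (insert j V) P" "indep V P"
  obtains p where "coeffs_in V p" "poly p (Var j) \<in> P" "poly (pderiv p) (Var j) \<notin> P"
proof -
  let ?Q = "\<lambda>p. coeffs_in V p \<and> poly p (Var j) \<in> P \<and> degree p > 0"
  obtain p where p: "?Q p" "\<And>r. degree r < degree p \<Longrightarrow> \<not> ?Q r"
    using dependent_poly[OF assms] exists_least_iff[of "\<lambda>m. \<exists>p. ?Q p \<and> degree p = m"] by metis
  have c: "coeffs_in V (pderiv p)" using p(1) by (auto simp: coeffs_in_def coeff_pderiv)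
  have "poly (pderiv p) (Var j) \<notin> P"
  proof
    assume a: "poly (pderiv p) (Var j) \<in> P"
    show False
    proof (cases "degree (pderiv p) > 0")
      case True
      then show ?thesis using p(2)[of "pderiv p"] a c p(1) by (simp add: degree_pderiv)
    next
      case False
      then obtain e where e: "pderiv p = [:e:]" using degree_eq_zeroE by blast
      then have "e \<in> polys_in V" using c by (auto simp: coeffs_in_def dest: spec[of _ 0])
      then have "e = 0" using a e assms(2) by (simp add: indep_def)
      then have "pderiv p = 0" using e by simp
      then show ?thesis using p(1) by (simp add: pderiv_eq_0_iff)
    qed
  qed
  then show ?thesis using that p by blast
qed

text \<open>For each x-variable \<open>b j\<close> is a nonzero multiple, modulo \<open>P\<close>,
  of the derivative of a separable relation, taken in \<open>K[t]\<close> by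
  \<open>invertible_mod_prime\<close>. Where the product \<open>h\<close> of all \<open>b j\<close>
  is nonzero these derivatives are units on the fibre, and \<open>simple_roots_mod_ideal\<close>
  applies.\<close>

lemma fiber_coordinates:
  fixes P :: "'k::{alg_closed_field, field_char_0} mpoly set"
  assumes dim: "ideal_dim n I d" "I \<subseteq> P" and P: "is_prime_ideal n P" and d: "d \<le> n" and t: "indep {..<d} P"
  shows "\<exists>h\<in>polys_in {..<d}. h \<noteq> 0 \<and> (\<forall>q j. eval q h \<noteq> 0 \<longrightarrow> j < n \<longrightarrow>
    (\<exists>S. finite S \<and> (\<Prod>c\<in>S. Var j - Const c) \<in> fiber n d P q))"
proof -
  have PI: "is_ideal n P" using P by (simp add: is_prime_ideal_def)
  define Q where "Q j p r b \<longleftrightarrow> coeffs_in {..<d} p \<and> poly p (Var j) \<in> P \<and> r \<in> polys n \<and> b \<in> polys_in {..<d} \<and> b \<noteq> 0 \<and>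
     r * poly (pderiv p) (Var j) - b \<in> P" for j p r b
  have "\<exists>p r b. Q j p r b" if j: "j \<in> {d..<n}" for j
  proof -
    have "\<not> indep (insert j {..<d}) P"
      using indep_card_le_dim[OF dim P, of "insert j {..<d}"] j d by auto
    then obtain p where p: "coeffs_in {..<d} p" "poly p (Var j) \<in> P" "poly (pderiv p) (Var j) \<notin> P"
      using separable_poly t by blast
    have "coeffs_in {..<d} (pderiv p)" using p(1) by (auto simp: coeffs_in_def coeff_pderiv)
    then have "poly (pderiv p) (Var j) \<in> polys n"
      unfolding polys_eq by (rule poly_closed) (use j d in auto)
    then obtain r b where "r \<in> polys n" "b \<in> polys_in {..<d}" "b \<noteq> 0" "r * poly (pderiv p) (Var j) - b \<in> P"
      using invertible_mod_prime[OF dim P d _ p(3)] by blast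
    then show ?thesis using p unfolding Q_def by blast
  qed
  then obtain p r b where Q: "\<And>j. j \<in> {d..<n} \<Longrightarrow> Q j (p j) (r j) (b j)" by metis
  have p: "\<And>j. j \<in> {d..<n} \<Longrightarrow> coeffs_in {..<d} (p j)"
    "\<And>j. j \<in> {d..<n} \<Longrightarrow> poly (p j) (Var j) \<in> P" "\<And>j. j \<in> {d..<n} \<Longrightarrow> r j \<in> polys n"
    "\<And>j. j \<in> {d..<n} \<Longrightarrow> b j \<in> polys_in {..<d}" "\<And>j. j \<in> {d..<n} \<Longrightarrow> b j \<noteq> 0"
    "\<And>j. j \<in> {d..<n} \<Longrightarrow> r j * poly (pderiv (p j)) (Var j) - b j \<in> P"
    using Q unfolding Q_def by blast+
  let ?h = "\<Prod>j\<in>{d..<n}. b j"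
  show ?thesis
  proof (intro bexI[of _ ?h] conjI allI impI)
    show "?h \<in> polys_in {..<d}" by (rule polys_in_prod) (rule p(4))
    show "?h \<noteq> 0" using p(5) by (auto simp: prod_zero_iff)
    fix q j
    assume h: "eval q ?h \<noteq> 0" and j: "j < n"
    let ?J = "fiber n d P q"
    have J: "is_ideal n ?J" by (rule fiber_ideal[OF PI d])
    have PJ: "P \<subseteq> ?J" by (rule fiber_superset)
      show "\<exists>S. finite S \<and> (\<Prod>c\<in>S. Var j - Const c) \<in> ?J"
      proof (cases "j < d")
        case True
        then show ?thesis using fiber_Var[OF PI True] by (intro exI[of _ "{q j}"]) simp
      next
        case False
        then have jd: "j \<in> {d..<n}" using j by simp
        let ?x = "Var j :: 'k mpoly"
        have x: "?x \<in> polys n" using j by (simp add: polys_eq)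
        have cp: "coeffs_in {..<d} (pderiv (p j))" using p(1)[OF jd] by (auto simp: coeffs_in_def coeff_pderiv)
        have 1: "poly (map_poly Const (map_poly (eval q) (p j))) ?x \<in> ?J"
          using fiber_poly[OF PI d x p(1)[OF jd], of q] p(2)[OF jd] PJ ideal_eq_iff_diff[OF J] by blast
        have "poly (pderiv (p j)) ?x - poly (map_poly Const (map_poly (eval q) (pderiv (p j)))) ?x \<in> ?J"
          by (rule fiber_poly[OF PI d x cp])
        \<comment> \<open>Start from the congruence of \<open>r\<close> times the derivative with
          \<open>b\<close> modulo \<open>P\<close>, and replace on the fibre both the coefficients
          of the derivative and \<open>b\<close> by their values at \<open>q\<close>.\<close>
        then have "(r j * poly (pderiv (p j)) ?x - b j) -
            r j * (poly (pderiv (p j)) ?x - poly (map_poly Const (map_poly (eval q) (pderiv (p j)))) ?x) +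
            (b j - Const (eval q (b j))) \<in> ?J"
          using ideal_add[OF J ideal_diff[OF J subsetD[OF PJ p(6)[OF jd]] ideal_mult[OF J _ p(3)[OF jd]]]
            fiber_eval[OF PI d p(4)[OF jd]]] by blast
        then have 2: "r j * poly (map_poly Const (pderiv (map_poly (eval q) (p j)))) ?x - Const (eval q (b j)) \<in> ?J"
          by (simp add: pderiv_map_poly_eval algebra_simps)
        have "eval q (b j) \<noteq> 0" using h jd by (auto simp: prod_zero_iff)
        then show ?thesis using simple_roots_mod_ideal[OF J x 1 p(3)[OF jd] _ 2] by blast
      qed
  qed
qed

section \<open>Generic flatness and the theorem\<close>

text \<open>Vectors are functions of an index \<open>i\<close>, later the operator. This is linear
  independence over \<open>K[V]\<close> of the classes of \<open>C\<close> in the quotient by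
  \<open>H\<close>.\<close>

definition indep_modulo :: "nat set \<Rightarrow> ('i \<Rightarrow> ('k::comm_ring_1) mpoly) set \<Rightarrow> ('i \<Rightarrow> 'k mpoly) set \<Rightarrow> bool" where
  "indep_modulo V H C \<longleftrightarrow> (\<forall>c. (\<forall>v\<in>C. c v \<in> polys_in V) \<longrightarrow>
     (\<lambda>i. \<Sum>v\<in>C. c v * v i) \<in> H \<longrightarrow> (\<forall>v\<in>C. c v = 0))"

definition span_modulo :: "nat set \<Rightarrow> ('i \<Rightarrow> ('k::comm_ring_1) mpoly) set \<Rightarrow> ('i \<Rightarrow> 'k mpoly) set \<Rightarrow> ('i \<Rightarrow> 'k mpoly) set" where
  "span_modulo V H C = {u. \<exists>c. (\<forall>v\<in>C. c v \<in> polys_in V) \<and> (\<lambda>i. u i - (\<Sum>v\<in>C. c v * v i)) \<in> H}"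

text \<open>Generators are collected as long as independence lasts. When \<open>e\<close> breaks it,
  its coefficient \<open>c e\<close> in the resulting relation is nonzero, as \<open>C\<close> is
  independent, so \<open>c e\<close> times \<open>e\<close> lies in the span modulo
  \<open>H\<close>; multiplying \<open>h\<close> by \<open>c e\<close> keeps the earlier elements in
  the span.\<close>

lemma ex_basis_modulo:
  fixes H :: "('i \<Rightarrow> 'k::idom mpoly) set"
  assumes H0: "(\<lambda>i. 0) \<in> H" and Hadd: "\<And>u v. u \<in> H \<Longrightarrow> v \<in> H \<Longrightarrow> (\<lambda>i. u i + v i) \<in> H"
    and Hmult: "\<And>b u. b \<in> polys_in V \<Longrightarrow> u \<in> H \<Longrightarrow> (\<lambda>i. b * u i) \<in> H"
    and "finite E"
  shows "\<exists>C h. finite C \<and> h \<in> polys_in V \<and> h \<noteq> 0 \<and> indep_modulo V H C \<and>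
    (\<forall>e\<in>E. (\<lambda>i. h * e i) \<in> span_modulo V H C)"
  using assms(4)
proof (induction E rule: finite_induct)
  case empty
  then show ?case by (intro exI[of _ "{}"] exI[of _ 1]) (auto simp: indep_modulo_def)
next
  case (insert e E)
  then obtain C h where C: "finite C" "h \<in> polys_in V" "h \<noteq> 0" "indep_modulo V H C"
    and gen: "\<And>e. e \<in> E \<Longrightarrow> (\<lambda>i. h * e i) \<in> span_modulo V H C"
    by blast
  show ?case
  proof (cases "e \<in> C \<or> indep_modulo V H (insert e C)")
    case True
    then have ind': "indep_modulo V H (insert e C)" using C(4) by (auto simp: insert_absorb)
    have "(\<lambda>i. h * e' i) \<in> span_modulo V H (insert e C)" if "e' \<in> insert e E" for e'
    proof (cases "e' = e")
      case True
      let ?c = "\<lambda>v. if v = e then h else 0"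
      have "(\<Sum>v\<in>insert e C. ?c v * v i) = (\<Sum>v\<in>insert e C. if v = e then h * v i else 0)" for i
        by (rule sum.cong) auto
      then have "(\<Sum>v\<in>insert e C. ?c v * v i) = h * e i" for i
        using C by (simp add: sum.delta)
      then show ?thesis using True H0 C unfolding span_modulo_def
        by (intro CollectI exI[of _ ?c]) auto
    next
      case False
      then have "e' \<in> E" using that by simp
      from gen[OF this] obtain c where c: "\<forall>v\<in>C. c v \<in> polys_in V" "(\<lambda>i. h * e' i - (\<Sum>v\<in>C. c v * v i)) \<in> H"
        unfolding span_modulo_def mem_Collect_eq by (elim exE conjE)
      let ?c = "\<lambda>v. if v \<in> C then c v else 0"
      have "(\<Sum>v\<in>insert e C. ?c v * v i) = (\<Sum>v\<in>C. c v * v i)" for i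
        using C by (cases "e \<in> C") (auto simp: insert_absorb intro!: sum.cong)
      then show ?thesis using c unfolding span_modulo_def by (intro CollectI exI[of _ ?c]) auto
    qed
    then show ?thesis using C ind' by (intro exI[of _ "insert e C"] exI[of _ h]) auto
  next
    case False
    then obtain c where eC: "e \<notin> C" and c: "\<forall>v\<in>insert e C. c v \<in> polys_in V"
      "(\<lambda>i. \<Sum>v\<in>insert e C. c v * v i) \<in> H" "\<exists>v\<in>insert e C. c v \<noteq> 0"
      unfolding indep_modulo_def by blast
    have ce: "c e \<noteq> 0"
    proof
      assume "c e = 0"
      then have "(\<lambda>i. \<Sum>v\<in>C. c v * v i) \<in> H" using c(2) C eC by simp
      then show False using C(4) c \<open>c e = 0\<close> unfolding indep_modulo_def by auto
    qed
    have "(\<lambda>i. (h * c e) * e' i) \<in> span_modulo V H C" if "e' \<in> insert e E" for e'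
    proof (cases "e' = e")
      case True
      have "(\<lambda>i. h * (\<Sum>v\<in>insert e C. c v * v i)) \<in> H" using Hmult C(2) c(2) by blast
      also have "(\<lambda>i. h * (\<Sum>v\<in>insert e C. c v * v i)) =
          (\<lambda>i. (h * c e) * e' i - (\<Sum>v\<in>C. (- (h * c v)) * v i))"
        using C eC True by (simp add: sum_negf distrib_left sum_distrib_left mult.assoc)
      finally show ?thesis using c C unfolding span_modulo_def
        by (intro CollectI exI[of _ "\<lambda>v. - (h * c v)"]) auto
    next
      case False
      then have "e' \<in> E" using that by simp
      from gen[OF this] obtain c' where c': "\<forall>v\<in>C. c' v \<in> polys_in V" "(\<lambda>i. h * e' i - (\<Sum>v\<in>C. c' v * v i)) \<in> H"
        unfolding span_modulo_def mem_Collect_eq by (elim exE conjE)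
      have "(\<lambda>i. c e * (h * e' i - (\<Sum>v\<in>C. c' v * v i))) \<in> H" using Hmult c(1) c'(2) by blast
      also have "(\<lambda>i. c e * (h * e' i - (\<Sum>v\<in>C. c' v * v i))) =
          (\<lambda>i. (h * c e) * e' i - (\<Sum>v\<in>C. (c e * c' v) * v i))"
        by (simp add: right_diff_distrib sum_distrib_left ac_simps)
      finally show ?thesis using c c' unfolding span_modulo_def
        by (intro CollectI exI[of _ "\<lambda>v. c e * c' v"]) auto
    qed
    moreover have "h * c e \<in> polys_in V" "h * c e \<noteq> 0" using C c ce by auto
    ultimately show ?thesis using C(1,4) by (intro exI[of _ C] exI[of _ "h * c e"]) blast
  qed
qed

section \<open>Passage of injectivity to the fibre\<close>

lemma generated_uniform:
  assumes P: "is_ideal n P" and V: "V \<subseteq> {..<n}" "a \<in> polys_in V" and "finite X"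
    and "\<And>x. x \<in> X \<Longrightarrow> u x \<in> generated V P a G"
  shows "\<exists>k c. (\<forall>x\<in>X. \<forall>g\<in>G. c x g \<in> polys_in V) \<and> (\<forall>x\<in>X. a ^ k * u x - (\<Sum>g\<in>G. c x g * g) \<in> P)"
  using assms(4,5)
proof (induction X rule: finite_induct)
  case empty
  then show ?case by simp
next
  case (insert y X)
  have n: "a ^ k \<in> polys n" for k using V polys_in_mono[OF V(1)] by (auto simp: polys_eq)
  obtain k c where c: "\<forall>x\<in>X. \<forall>g\<in>G. c x g \<in> polys_in V"
    "\<forall>x\<in>X. a ^ k * u x - (\<Sum>g\<in>G. c x g * g) \<in> P" using insert by auto
  obtain l e where e: "\<forall>g\<in>G. e g \<in> polys_in V" "a ^ l * u y - (\<Sum>g\<in>G. e g * g) \<in> P"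
    using insert.prems[of y] by (auto simp: generated_def lspan_def)
  let ?c = "\<lambda>x g. if x = y then a ^ k * e g else a ^ l * c x g"
  have A: "a ^ (k + l) * u x - (\<Sum>g\<in>G. ?c x g * g) \<in> P" if "x \<in> insert y X" for x
  proof (cases "x = y")
    case True
    have "a ^ k * (a ^ l * u y - (\<Sum>g\<in>G. e g * g)) \<in> P" by (rule ideal_mult[OF P e(2) n])
    then show ?thesis using True by (simp add: algebra_simps power_add sum_distrib_left)
  next
    case False
    then have "a ^ k * u x - (\<Sum>g\<in>G. c x g * g) \<in> P" using c that by auto
    then have "a ^ l * (a ^ k * u x - (\<Sum>g\<in>G. c x g * g)) \<in> P" by (rule ideal_mult[OF P _ n])
    then show ?thesis using False by (simp add: algebra_simps power_add sum_distrib_left)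
  qed
  have B: "\<forall>x\<in>insert y X. \<forall>g\<in>G. ?c x g \<in> polys_in V" using c e V by auto
  show ?case
    by (rule exI[of _ "k + l"], rule exI[of _ ?c], rule conjI[OF B], rule ballI, rule A)
qed

text \<open>\<open>H\<close> below is the image of \<open>R/I\<close> in \<open>(R/P)\<^sup>N\<close>; a maximal set \<open>C\<close> of generators independent modulo \<open>H\<close>
  is a basis of the cokernel after inverting \<open>h * a\<close>, so that no torsion obstructs passing to the fibre.\<close>

lemma fiber_injective:
  fixes P :: "'k::field_char_0 mpoly set"
  assumes P: "is_ideal n P" and d: "d \<le> n" and t: "indep {..<d} P"
    and alg: "\<And>j. j < n \<Longrightarrow> j \<notin> {..<d} \<Longrightarrow> \<not> indep (insert j {..<d}) P"
    and N: "finite N" "N \<subseteq> weyl_ops n" "\<forall>D\<in>N. x_only d n D"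
    and I: "is_ideal n I" "\<And>f. f \<in> polys n \<Longrightarrow> (\<forall>D\<in>N. apply_weyl D f \<in> P) \<Longrightarrow> f \<in> I"
  shows "\<exists>h\<in>polys_in {..<d}. h \<noteq> 0 \<and> (\<forall>q g. eval q h \<noteq> 0 \<longrightarrow> g \<in> polys n \<longrightarrow>
    (\<forall>D\<in>N. apply_weyl D g \<in> fiber n d P q) \<longrightarrow> g \<in> fiber n d I q)"
proof -
  let ?B = "polys_in {..<d} :: 'k mpoly set"
  have V: "{..<d} \<subseteq> {..<n}" using d by auto
  have Bn: "b \<in> polys n" if "b \<in> ?B" for b using polys_in_mono[OF V] that by (auto simp: polys_eq)
  obtain G a where G: "finite G" "G \<subseteq> polys n" and a: "a \<in> ?B" "a \<noteq> 0"
    and gen: "polys n \<subseteq> generated {..<d} P a G"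
    using finitely_generated[OF P V t alg] by blast
  \<comment> \<open>Only coordinates in \<open>N\<close>, and these only modulo \<open>P\<close>,
    matter. \<open>H\<close> is a \<open>K[t]\<close>-submodule because the operators are
    \<open>K[t]\<close>-linear.\<close>
  define H where "H = {u. \<exists>w\<in>polys n. \<forall>D\<in>N. u D - apply_weyl D w \<in> P}"
  have H0: "u \<in> H" if "\<forall>D\<in>N. u D \<in> P" for u
    unfolding H_def using that by (intro CollectI bexI[of _ 0]) (auto simp: polys_eq)
  have Hadd: "(\<lambda>D. u D + v D) \<in> H" if uv: "u \<in> H" "v \<in> H" for u v
  proof -
    obtain w w' where w: "w \<in> polys n" "\<forall>D\<in>N. u D - apply_weyl D w \<in> P"
      "w' \<in> polys n" "\<forall>D\<in>N. v D - apply_weyl D w' \<in> P" using uv by (auto simp: H_def)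
    have "u D + v D - apply_weyl D (w + w') \<in> P" if "D \<in> N" for D
      using ideal_add[OF P, of "u D - apply_weyl D w" "v D - apply_weyl D w'"] w that
      by (simp add: apply_weyl_add algebra_simps)
    then show ?thesis using w unfolding H_def by (intro CollectI bexI[of _ "w + w'"]) (auto simp: polys_eq)
  qed
  have Hmult: "(\<lambda>D. b * u D) \<in> H" if bu: "b \<in> ?B" "u \<in> H" for b u
  proof -
    obtain w where w: "w \<in> polys n" "\<forall>D\<in>N. u D - apply_weyl D w \<in> P" using bu by (auto simp: H_def)
    have "b * u D - apply_weyl D (b * w) \<in> P" if "D \<in> N" for D
    proof -
      have "b * (u D - apply_weyl D w) \<in> P" using w that Bn[OF bu(1)] by (intro ideal_mult[OF P]) auto
      then show ?thesis using apply_weyl_mult_t[of d n D b w] N(3) that bu(1)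
        by (simp add: right_diff_distrib)
    qed
    then show ?thesis using w Bn[OF bu(1)] unfolding H_def
      by (intro CollectI bexI[of _ "b * w"]) (auto simp: polys_eq)
  qed
  have Hsum: "(\<lambda>D. \<Sum>x\<in>X. u x D) \<in> H" if "\<And>x. x \<in> X \<Longrightarrow> u x \<in> H" for u and X :: "'x set"
    using that
  proof (induction X rule: infinite_finite_induct)
    case (insert x X)
    then show ?case using Hadd[of "u x" "\<lambda>D. \<Sum>x\<in>X. u x D"] by simp
  qed (use H0 ideal_0[OF P] in auto)
  \<comment> \<open>The vector with \<open>g\<close> in position \<open>D\<close> and 0 elsewhere.
    For \<open>g\<close> in \<open>G\<close> these vectors generate the product of copies of
    \<open>R/P\<close> over \<open>K[t]\<close> with \<open>a\<close> inverted.\<close>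
  define unit where "unit = (\<lambda>(D :: 'k weyl, g) D'. if D' = D then g else (0 :: 'k mpoly))"
  have "\<exists>C h. finite C \<and> h \<in> ?B \<and> h \<noteq> 0 \<and> indep_modulo {..<d} H C \<and>
      (\<forall>e\<in>unit ` (N \<times> G). (\<lambda>D. h * e D) \<in> span_modulo {..<d} H C)"
    by (rule ex_basis_modulo[OF _ Hadd Hmult]) (use H0 ideal_0[OF P] N(1) G(1) in auto)
  then obtain C h where C: "finite C" "h \<in> ?B" "h \<noteq> 0"
    and ind0: "indep_modulo {..<d} H C"
    and basis: "\<And>x. x \<in> N \<times> G \<Longrightarrow> (\<lambda>D. h * unit x D) \<in> span_modulo {..<d} H C"
    by blast
  have ind: "\<forall>v\<in>C. c v = 0" if "(\<lambda>D. \<Sum>v\<in>C. c v * v D) \<in> H" "\<forall>v\<in>C. c v \<in> ?B" for c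
    using ind0 that unfolding indep_modulo_def by blast
  have "\<forall>x\<in>N \<times> G. \<exists>c. (\<forall>v\<in>C. c v \<in> ?B) \<and> (\<lambda>D. h * unit x D - (\<Sum>v\<in>C. c v * v D)) \<in> H"
    using basis unfolding span_modulo_def mem_Collect_eq by blast
  from bchoice[OF this] obtain b where b': "\<forall>x\<in>N \<times> G. (\<forall>v\<in>C. b x v \<in> ?B) \<and>
    (\<lambda>D. h * unit x D - (\<Sum>v\<in>C. b x v * v D)) \<in> H" ..
  have b: "\<forall>v\<in>C. b x v \<in> ?B" "(\<lambda>D. h * unit x D - (\<Sum>v\<in>C. b x v * v D)) \<in> H" if "x \<in> N \<times> G" for x
    using bspec[OF b' that] by auto
  \<comment> \<open>A vector already written over \<open>G\<close> with denominator
    \<open>a ^ k\<close> is rewritten over \<open>C\<close> modulo \<open>H\<close>, at the cost of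
    the further denominator \<open>h\<close>.\<close>
  have expand: "\<exists>c. (\<forall>v\<in>C. c v \<in> ?B) \<and> (\<lambda>D. h * a ^ k * u D - (\<Sum>v\<in>C. c v * v D)) \<in> H"
    if e: "\<forall>D\<in>N. \<forall>g\<in>G. e D g \<in> ?B" "\<forall>D\<in>N. a ^ k * u D - (\<Sum>g\<in>G. e D g * g) \<in> P" for k e u
  proof -
    define c where "c v = (\<Sum>(D, g)\<in>N \<times> G. e D g * b (D, g) v)" for v
    have "(\<lambda>D'. \<Sum>x\<in>N \<times> G. e (fst x) (snd x) * (h * unit x D' - (\<Sum>v\<in>C. b x v * v D'))) \<in> H"
      using e b by (intro Hsum Hmult) auto
    moreover have "(\<lambda>D. h * (a ^ k * u D - (\<Sum>g\<in>G. e D g * g))) \<in> H"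
      using e by (intro Hmult[OF C(2)] H0) auto
    ultimately have *: "(\<lambda>D'. (\<Sum>x\<in>N \<times> G. e (fst x) (snd x) * (h * unit x D' - (\<Sum>v\<in>C. b x v * v D'))) +
      h * (a ^ k * u D' - (\<Sum>g\<in>G. e D' g * g))) \<in> H" by (rule Hadd)
    have "(\<Sum>x\<in>N \<times> G. e (fst x) (snd x) * unit x D') = (\<Sum>g\<in>G. e D' g * g)" if "D' \<in> N" for D'
    proof -
      have "(\<Sum>x\<in>N \<times> G. e (fst x) (snd x) * unit x D') = (\<Sum>D\<in>N. \<Sum>g\<in>G. e D g * unit (D, g) D')"
        by (simp add: sum.cartesian_product split_def)
      also have "\<dots> = (\<Sum>D\<in>N. if D = D' then (\<Sum>g\<in>G. e D g * g) else 0)"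
        by (intro sum.cong) (auto simp: unit_def)
      also have "\<dots> = (\<Sum>g\<in>G. e D' g * g)" using N(1) that by (simp add: sum.delta)
      finally show ?thesis .
    qed
    moreover have "(\<Sum>x\<in>N \<times> G. e (fst x) (snd x) * (\<Sum>v\<in>C. b x v * v D')) = (\<Sum>v\<in>C. c v * v D')" for D'
    proof -
      have "(\<Sum>x\<in>N \<times> G. e (fst x) (snd x) * (\<Sum>v\<in>C. b x v * v D')) =
          (\<Sum>x\<in>N \<times> G. \<Sum>v\<in>C. e (fst x) (snd x) * b x v * v D')"
        by (simp add: sum_distrib_left mult.assoc)
      also have "\<dots> = (\<Sum>v\<in>C. \<Sum>x\<in>N \<times> G. e (fst x) (snd x) * b x v * v D')" by (rule sum.swap)
      finally show ?thesis by (simp add: c_def sum_distrib_right split_def)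
    qed
    ultimately have eq: "(\<Sum>x\<in>N \<times> G. e (fst x) (snd x) * (h * unit x D' - (\<Sum>v\<in>C. b x v * v D'))) +
        h * (a ^ k * u D' - (\<Sum>g\<in>G. e D' g * g)) = h * a ^ k * u D' - (\<Sum>v\<in>C. c v * v D')"
      if "D' \<in> N" for D'
    proof -
      have "(\<Sum>x\<in>N \<times> G. e (fst x) (snd x) * (h * unit x D' - (\<Sum>v\<in>C. b x v * v D'))) =
        h * (\<Sum>x\<in>N \<times> G. e (fst x) (snd x) * unit x D') -
          (\<Sum>x\<in>N \<times> G. e (fst x) (snd x) * (\<Sum>v\<in>C. b x v * v D'))"
        by (simp add: right_diff_distrib sum_subtractf sum_distrib_left mult.left_commute)
      with that show ?thesis
        using \<open>\<And>D'. D' \<in> N \<Longrightarrow> (\<Sum>x\<in>N \<times> G. e (fst x) (snd x) * unit x D') = (\<Sum>g\<in>G. e D' g * g)\<close>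
          \<open>\<And>D'. (\<Sum>x\<in>N \<times> G. e (fst x) (snd x) * (\<Sum>v\<in>C. b x v * v D')) = (\<Sum>v\<in>C. c v * v D')\<close>
        by (simp add: algebra_simps)
    qed
    have "(\<lambda>D. h * a ^ k * u D - (\<Sum>v\<in>C. c v * v D)) \<in> H"
      using * eq unfolding H_def by simp
    moreover have "\<forall>v\<in>C. c v \<in> ?B"
    proof
      fix v assume v: "v \<in> C"
      show "c v \<in> ?B" unfolding c_def
      proof (rule polys_in_sum)
        fix x assume x: "x \<in> N \<times> G"
        then have "b x v \<in> ?B" using b(1) v by blast
        then show "(case x of (D, g) \<Rightarrow> e D g * b (D, g) v) \<in> ?B" using e(1) x by auto
      qed
    qed
    ultimately show ?thesis by blast
  qed
  show ?thesis
  proof (intro bexI[of _ "h * a"] conjI allI impI)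
    show "h * a \<in> ?B" "h * a \<noteq> 0" using C a by auto
    fix q and g :: "'k mpoly"
    assume q: "eval q (h * a) \<noteq> 0" and g: "g \<in> polys n"
      and D: "\<forall>D\<in>N. apply_weyl D g \<in> fiber n d P q"
    let ?\<tau> = "\<lambda>l. Var l - Const (q l) :: 'k mpoly"
    have \<tau>: "?\<tau> l \<in> ?B" if "l < d" for l using that by simp
    have "\<exists>u. \<forall>D\<in>N. (\<forall>l. u D l \<in> polys n) \<and> apply_weyl D g - (\<Sum>l<d. ?\<tau> l * u D l) \<in> P"
    proof (rule bchoice, rule ballI)
      fix E assume "E \<in> N"
      then obtain m u where "apply_weyl E g = m + (\<Sum>l<d. ?\<tau> l * u l)" "m \<in> P" "\<forall>l. u l \<in> polys n"
        using D by (auto simp: fiber_def)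
      then show "\<exists>u. (\<forall>l. u l \<in> polys n) \<and> apply_weyl E g - (\<Sum>l<d. ?\<tau> l * u l) \<in> P"
        by (intro exI[of _ u]) auto
    qed
    then obtain u where u: "\<And>D l. D \<in> N \<Longrightarrow> u D l \<in> polys n"
      "\<And>D. D \<in> N \<Longrightarrow> apply_weyl D g - (\<Sum>l<d. ?\<tau> l * u D l) \<in> P" by blast
    have "\<exists>k c. (\<forall>x\<in>N \<times> {..<d}. \<forall>g\<in>G. c x g \<in> ?B) \<and>
        (\<forall>x\<in>N \<times> {..<d}. a ^ k * u (fst x) (snd x) - (\<Sum>g\<in>G. c x g * g) \<in> P)"
      using N(1) u(1) gen by (intro generated_uniform[OF P V a(1)]) auto
    then obtain k c where c': "\<forall>x\<in>N \<times> {..<d}. \<forall>g\<in>G. c x g \<in> ?B"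
      "\<forall>x\<in>N \<times> {..<d}. a ^ k * u (fst x) (snd x) - (\<Sum>g\<in>G. c x g * g) \<in> P"
      by (elim exE conjE)
    have c: "\<And>D l g. D \<in> N \<Longrightarrow> l < d \<Longrightarrow> g \<in> G \<Longrightarrow> c (D, l) g \<in> ?B"
      "\<And>D l. D \<in> N \<Longrightarrow> l < d \<Longrightarrow> a ^ k * u D l - (\<Sum>g\<in>G. c (D, l) g * g) \<in> P" using c' by auto
    have "\<exists>c. (\<forall>v\<in>C. c v \<in> ?B) \<and> (\<lambda>D. h * a ^ k * u D l - (\<Sum>v\<in>C. c v * v D)) \<in> H" if "l < d" for l
      using c that by (intro expand[of "\<lambda>D. c (D, l)"]) auto
    moreover define Q where "Q l c w \<longleftrightarrow> (\<forall>v\<in>C. c v \<in> ?B) \<and> w \<in> polys n \<and>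
        (\<forall>D\<in>N. h * a ^ k * u D l - (\<Sum>v\<in>C. c v * v D) - apply_weyl D w \<in> P)" for l c w
    ultimately have "\<exists>c w. Q l c w" if "l < d" for l
      using that unfolding H_def by blast
    then obtain e w where Q: "\<And>l. l < d \<Longrightarrow> Q l (e l) (w l)" by metis
    have e: "\<And>l v. l < d \<Longrightarrow> v \<in> C \<Longrightarrow> e l v \<in> ?B" "\<And>l. l < d \<Longrightarrow> w l \<in> polys n"
      "\<And>l D. l < d \<Longrightarrow> D \<in> N \<Longrightarrow> h * a ^ k * u D l - (\<Sum>v\<in>C. e l v * v D) - apply_weyl D (w l) \<in> P"
      using Q unfolding Q_def by blast+
    \<comment> \<open>Modulo \<open>P\<close>, \<open>h * a ^ k * u D l\<close> is a combination of
      \<open>C\<close> plus the image of \<open>w l\<close>. Subtracting the \<open>w l\<close>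
      leaves for the image of \<open>z\<close> only a combination of \<open>C\<close>, with
      coefficients in \<open>K[t]\<close>.\<close>
    define z where "z = h * a ^ k * g - (\<Sum>l<d. ?\<tau> l * w l)"
    have hB: "h * a ^ k \<in> ?B" using C a by simp
    have zn: "z \<in> polys n"
    proof -
      have "?\<tau> l * w l \<in> polys n" if "l < d" for l
        using Bn[OF \<tau>[OF that]] e(2)[OF that] by (simp add: polys_eq)
      then have "(\<Sum>l<d. ?\<tau> l * w l) \<in> polys n" unfolding polys_eq by (rule polys_in_sum) auto
      then show ?thesis using Bn[OF hB] g by (simp add: z_def polys_eq)
    qed
    have wz: "apply_weyl D z = h * a ^ k * apply_weyl D g - (\<Sum>l<d. ?\<tau> l * apply_weyl D (w l))" if "D \<in> N" for D
    proof -
      have x: "x_only d n D" using N(3) that by blast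
      have "(\<Sum>l<d. apply_weyl D (?\<tau> l * w l)) = (\<Sum>l<d. ?\<tau> l * apply_weyl D (w l))"
        by (rule sum.cong[OF refl]) (use \<tau> in \<open>simp add: apply_weyl_mult_t[OF x]\<close>)
      then show ?thesis by (simp add: z_def apply_weyl_diff apply_weyl_sum apply_weyl_mult_t[OF x hB])
    qed
    have key: "apply_weyl D z - (\<Sum>v\<in>C. (\<Sum>l<d. ?\<tau> l * e l v) * v D) \<in> P" if D: "D \<in> N" for D
    proof -
      have "h * a ^ k * (apply_weyl D g - (\<Sum>l<d. ?\<tau> l * u D l)) +
          (\<Sum>l<d. ?\<tau> l * (h * a ^ k * u D l - (\<Sum>v\<in>C. e l v * v D) - apply_weyl D (w l))) \<in> P"
      proof (rule ideal_add[OF P])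
        show "h * a ^ k * (apply_weyl D g - (\<Sum>l<d. ?\<tau> l * u D l)) \<in> P"
          by (rule ideal_mult[OF P u(2)[OF D] Bn[OF hB]])
        show "(\<Sum>l<d. ?\<tau> l * (h * a ^ k * u D l - (\<Sum>v\<in>C. e l v * v D) - apply_weyl D (w l))) \<in> P"
          by (rule ideal_sum[OF P], rule ideal_mult[OF P e(3)[OF _ D]]) (use Bn \<tau> in auto)
      qed
      also have "h * a ^ k * (apply_weyl D g - (\<Sum>l<d. ?\<tau> l * u D l)) +
          (\<Sum>l<d. ?\<tau> l * (h * a ^ k * u D l - (\<Sum>v\<in>C. e l v * v D) - apply_weyl D (w l))) =
          apply_weyl D z - (\<Sum>l<d. ?\<tau> l * (\<Sum>v\<in>C. e l v * v D))"
        unfolding wz[OF D]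
        by (simp add: right_diff_distrib sum_subtractf sum_distrib_left mult.left_commute)
      also have "(\<Sum>l<d. ?\<tau> l * (\<Sum>v\<in>C. e l v * v D)) = (\<Sum>v\<in>C. (\<Sum>l<d. ?\<tau> l * e l v) * v D)"
        unfolding sum_distrib_left sum_distrib_right by (subst sum.swap) (simp add: mult.assoc)
      finally show ?thesis .
    qed
    \<comment> \<open>The combination is the image of \<open>z\<close>, so it is 0 in the cokernel.
      Independence of \<open>C\<close> kills its coefficients, which puts
      \<open>apply_weyl D z\<close> in \<open>P\<close> for all \<open>D\<close> in \<open>N\<close>
      and \<open>z\<close> in \<open>I\<close>.\<close>
    have "(\<lambda>D. \<Sum>v\<in>C. (\<Sum>l<d. ?\<tau> l * e l v) * v D) \<in> H"
      unfolding H_def using zn key ideal_diff_sym[OF P] by blast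
    then have "\<forall>v\<in>C. (\<Sum>l<d. ?\<tau> l * e l v) = 0"
    proof (rule ind)
      show "\<forall>v\<in>C. (\<Sum>l<d. ?\<tau> l * e l v) \<in> ?B"
        by (intro ballI polys_in_sum polys_in_mult \<tau> e(1)) auto
    qed
    then have "apply_weyl D z \<in> P" if "D \<in> N" for D using key[OF that] by simp
    then have zI: "z \<in> I" using I(2) zn by blast
    have IF: "is_ideal n (fiber n d I q)" by (rule fiber_ideal[OF I(1) d])
    have "(\<Sum>l<d. ?\<tau> l * w l) \<in> fiber n d I q"
      by (rule ideal_sum[OF IF], rule ideal_mult_right[OF IF fiber_Var[OF I(1)]]) (use e(2) in auto)
    then have "z + (\<Sum>l<d. ?\<tau> l * w l) \<in> fiber n d I q"
      using zI fiber_superset by (intro ideal_add[OF IF]) blast+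
    \<comment> \<open>The difference between this and \<open>z\<close> lies in the ideal of
      \<open>t - t_0\<close>. On the fibre the factor \<open>h * a ^ k\<close> is a nonzero constant
      and can be cancelled.\<close>
    then have "h * a ^ k * g \<in> fiber n d I q" by (simp add: z_def)
    moreover have "h * a ^ k * g - Const (eval q (h * a ^ k)) * g \<in> fiber n d I q"
      using ideal_mult_right[OF IF fiber_eval[OF I(1) d hB] g] by (simp add: left_diff_distrib)
    ultimately have "Const (eval q (h * a ^ k)) * g \<in> fiber n d I q"
      using ideal_eq_iff_diff[OF IF] by blast
    then show "g \<in> fiber n d I q"
      by (rule ideal_Const_cancel[OF IF, rotated]) (use q in simp)
  qed
qed

text \<open>Points of the variety have their \<open>j\<close>-th coordinate in the finite set
  \<open>S j\<close>. Hence the product \<open>y\<close> of all factors \<open>x_j - c\<close> with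
  \<open>c\<close> in \<open>S j\<close> other than \<open>q j\<close> vanishes at every point of
  the variety except possibly \<open>q\<close>, and is nonzero at \<open>q\<close>.\<close>

lemma ex_localizer:
  fixes q :: "nat \<Rightarrow> 'k::field"
  assumes J: "J \<subseteq> polys n" and q: "q \<in> points n"
    and S: "\<And>j. j < n \<Longrightarrow> \<exists>S. finite S \<and> (\<Prod>c\<in>S. Var j - Const c) \<in> J"
  obtains e where "e \<in> polys n" "\<And>f. e * f - f \<in> vanish q L"
    "\<And>q' f. q' \<in> variety n J \<Longrightarrow> q' \<noteq> q \<Longrightarrow> e * f \<in> vanish q' L"
proof -
  obtain S where S: "\<And>j. j < n \<Longrightarrow> finite (S j)" "\<And>j. j < n \<Longrightarrow> (\<Prod>c\<in>S j. Var j - Const c) \<in> J"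
    using S by metis
  define y where "y = (\<Prod>j<n. \<Prod>c\<in>S j - {q j}. Var j - Const c)"
  define y' where "y' = Const (inverse (eval q y)) * y"
  have "eval q y \<noteq> 0" using S(1) by (auto simp: y_def prod_zero_iff)
  then have y'q: "eval q y' = 1" by (simp add: y'_def)
  have "y \<in> polys n" unfolding y_def polys_eq by (intro polys_in_prod polys_in_diff) auto
  then have y'n: "y' \<in> polys n" by (simp add: y'_def polys_eq)
  have y'0: "eval q' y' = 0" if q': "q' \<in> variety n J" "q' \<noteq> q" for q'
  proof -
    obtain j where j: "j < n" "q' j \<noteq> q j"
      using q' q by (auto simp: variety_def points_def fun_eq_iff) (metis not_le)
    have "eval q' (\<Prod>c\<in>S j. Var j - Const c) = 0" using q' S(2)[OF j(1)] by (auto simp: variety_def)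
    then have "q' j \<in> S j" using S(1)[OF j(1)] by (auto simp: prod_zero_iff)
    then have "(\<Prod>c\<in>S j - {q j}. q' j - c) = 0" using S(1)[OF j(1)] j(2)
      by (intro prod_zero bexI[of _ "q' j"]) auto
    then have "eval q' y = 0" using j(1) by (auto simp: y_def intro!: prod_zero)
    then show ?thesis by (simp add: y'_def)
  qed
  \<comment> \<open>\<open>1 - y' ^ L\<close> is 0 at \<open>q\<close>, so its \<open>L\<close>-th
    power vanishes there to order \<open>L\<close> and \<open>e\<close> is 1 to that order. By the
    geometric sum \<open>e\<close> is also a multiple of \<open>y' ^ L\<close>, hence vanishes to
    order \<open>L\<close> at the other points.\<close>
  define e where "e = 1 - (1 - y' ^ L) ^ L"
  show ?thesis
  proof (rule that)
    show "e \<in> polys n" using y'n by (simp add: e_def polys_eq)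
    fix f :: "'k mpoly"
    have "(1 - y' ^ L) ^ L * (- f) \<in> vanish q L" by (rule vanish_power) (simp add: y'q)
    then show "e * f - f \<in> vanish q L" by (simp add: e_def algebra_simps)
    fix q' assume "q' \<in> variety n J" "q' \<noteq> q"
    then have "y' ^ L * ((\<Sum>i<L. (1 - y' ^ L) ^ i) * f) \<in> vanish q' L"
      by (intro vanish_power y'0)
    moreover have "e = y' ^ L * (\<Sum>i<L. (1 - y' ^ L) ^ i)"
      using one_diff_power_eq[of "1 - y' ^ L" L] by (simp add: e_def)
    ultimately show "e * f \<in> vanish q' L" by (simp add: mult.assoc)
  qed
qed

section \<open>Operators and ideals at a single point\<close>

lemma radical_vanishes: "q \<in> variety n I \<Longrightarrow> f \<in> radical n I \<Longrightarrow> eval q f = (0 :: 'k::idom)"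
  unfolding variety_def radical_def by (smt (verit) eval_power mem_Collect_eq power_eq_0_iff)

lemma fiber_subset_ideal_gen: "fiber n d I q \<subseteq> ideal_gen n (I \<union> {Var i - Const (q i) | i. i < d})"
proof
  fix f assume "f \<in> fiber n d I q"
  then obtain m u where f: "f = m + (\<Sum>l<d. (Var l - Const (q l)) * u l)" "m \<in> I" "\<forall>l. u l \<in> polys n"
    by (auto simp: fiber_def)
  show "f \<in> ideal_gen n (I \<union> {Var i - Const (q i) | i. i < d})"
    unfolding ideal_gen_def
  proof (intro InterI)
    fix J assume "J \<in> {J. is_ideal n J \<and> I \<union> {Var i - Const (q i) | i. i < d} \<subseteq> J}"
    then have J: "is_ideal n J" "I \<subseteq> J" "\<And>i. i < d \<Longrightarrow> Var i - Const (q i) \<in> J" by auto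
    have "(\<Sum>l<d. (Var l - Const (q l)) * u l) \<in> J"
      by (rule ideal_sum[OF J(1)], rule ideal_mult_right[OF J(1) J(3)]) (use f(3) in auto)
    then show "f \<in> J" unfolding f(1) using J(2) f(2) by (intro ideal_add[OF J(1)]) auto
  qed
qed

text \<open>\<open>D\<close> is not \<open>R\<close>-linear, so vanishing at \<open>q\<close> on
  generators does not by itself pass to their multiples.\<close>

lemma specialize_kills_ideal_gen:
  fixes I :: "'k::idom mpoly set"
  assumes I: "is_ideal n I" and d: "d \<le> n" and q: "q \<in> variety n I"
    and N: "D \<in> weyl_ops n" "x_only d n D" "\<And>f. f \<in> I \<Longrightarrow> apply_weyl D f \<in> radical n I"
    and f: "f \<in> ideal_gen n (I \<union> {Var i - Const (q i) | i. i < d})"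
  shows "pairing q (specialize q D) f = 0"
proof -
  \<comment> \<open>Imposing the condition on all multiples of \<open>f\<close> makes the set an
    ideal. It contains \<open>Var i - Const (q i)\<close> for \<open>i < d\<close> because this
    factor can be moved in front of \<open>D\<close>.\<close>
  let ?J = "{f \<in> polys n. \<forall>r\<in>polys n. eval q (apply_weyl D (r * f)) = 0}"
  have "is_ideal n ?J" unfolding is_ideal_def
    by (auto simp: polys_eq distrib_left apply_weyl_add simp flip: mult.assoc)
  moreover have "I \<subseteq> ?J"
    using ideal_subset[OF I] ideal_mult[OF I] N(3) radical_vanishes[OF q] by blast
  moreover have "Var i - Const (q i) \<in> ?J" if "i < d" for i
  proof -
    have "apply_weyl D (r * (Var i - Const (q i))) = (Var i - Const (q i)) * apply_weyl D r" for r
      using apply_weyl_mult_t[OF N(2), of "Var i - Const (q i)" r] that by (simp add: mult.commute)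
    then show ?thesis using that d by (simp add: polys_eq)
  qed
  ultimately have "f \<in> ?J" using f unfolding ideal_gen_def by blast
  moreover have "1 \<in> polys n" by (simp add: polys_eq)
  ultimately have "eval q (apply_weyl D (1 * f)) = 0" by blast
  then show ?thesis by (simp add: eval_apply_weyl)
qed

lemma specialize_const_ops: "D \<in> weyl_ops n \<Longrightarrow> specialize q D \<in> const_ops n"
  using keys_specialize[of q D] by (auto simp: weyl_ops_def const_ops_def)

lemma cspan_subset_punctual_ops:
  assumes "S \<subseteq> punctual_ops n q J"
  shows "cspan S \<subseteq> punctual_ops n q J"
proof
  fix D assume "D \<in> cspan S"
  then obtain T c where T: "T \<subseteq> S" "D = (\<Sum>E\<in>T. cscale (c E) E)" by (auto simp: cspan_def)
  have "Poly_Mapping.keys D \<subseteq> (\<Union>E\<in>T. Poly_Mapping.keys (cscale (c E) E))"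
    unfolding T(2) by (rule keys_sum)
  also have "\<dots> \<subseteq> (\<Union>E\<in>T. Poly_Mapping.keys E)" using keys_cscale by (intro UN_mono) auto
  also have "\<dots> \<subseteq> monoms_in {..<n}" using T(1) assms by (auto simp: punctual_ops_def const_ops_def)
  finally have "D \<in> const_ops n" by (simp add: const_ops_def)
  moreover have "pairing q D f = 0" if "f \<in> J" for f
    using T(1) assms that unfolding T(2) pairing_sum_left pairing_cscale
    by (intro sum.neutral) (auto simp: punctual_ops_def eval_apply_const)
  ultimately show "D \<in> punctual_ops n q J" by (simp add: punctual_ops_def eval_apply_const)
qed

section \<open>The span of the specialized operators over a general point\<close>

theorem theorem4p1:
  fixes n d :: nat
    and I :: "('k::{alg_closed_field, field_char_0}) mpoly set"
    and N :: "'k weyl set"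
  assumes "d \<le> n"
    and "is_primary_ideal n I"
    and "ideal_dim n I d"
    and "indep_vars d I"
    and "finite N"
    and "minimal_noetherian_ops n I N"
    and "\<forall>D\<in>N. x_only d n D"
  shows "\<exists>Z. zariski_closed d Z \<and> Z \<noteq> points d \<and>
           (\<forall>q\<in>variety n I. t_part d q \<notin> Z \<longrightarrow>
              cspan (specialize q ` N)
                = punctual_ops n q (ideal_gen n (I \<union> {Var i - Const (q i) | i. i < d})))"
proof -
  let ?P = "radical n I"
  have I: "is_ideal n I" using assms(2) by (simp add: is_primary_ideal_def)
  have P: "is_prime_ideal n ?P" by (rule radical_prime[OF assms(2)])
  then have PI: "is_ideal n ?P" by (simp add: is_prime_ideal_def)
  have IP: "I \<subseteq> ?P" using ideal_subset[OF I] by (auto simp: radical_def intro!: exI[of _ 1])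
  have t: "indep {..<d} ?P" unfolding indep_def
  proof (intro ballI impI)
    fix f assume f: "f \<in> polys_in {..<d}" "f \<in> ?P"
    then obtain k where "f ^ k \<in> I" by (auto simp: radical_def)
    moreover have "f ^ k \<in> polys d" using f(1) by (simp add: polys_eq)
    ultimately have "f ^ k = 0" using assms(4) unfolding indep_vars_def by blast
    then show "f = 0" by simp
  qed
  have alg: "\<not> indep (insert j {..<d}) ?P" if "j < n" "j \<notin> {..<d}" for j
    using indep_card_le_dim[OF assms(3) IP P, of "insert j {..<d}"] that assms(1) by auto
  have noeth: "N \<subseteq> weyl_ops n" "\<And>f. f \<in> polys n \<Longrightarrow> f \<in> I \<longleftrightarrow> (\<forall>D\<in>N. apply_weyl D f \<in> ?P)"
    using assms(6) unfolding minimal_noetherian_ops_def noetherian_ops_def by blast+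
  have I2: "f \<in> I" if "f \<in> polys n" "\<forall>D\<in>N. apply_weyl D f \<in> ?P" for f
    using noeth(2) that by blast
  have "\<exists>h\<in>polys_in {..<d}. h \<noteq> 0 \<and> (\<forall>q g. eval q h \<noteq> 0 \<longrightarrow> g \<in> polys n \<longrightarrow>
      (\<forall>D\<in>N. apply_weyl D g \<in> fiber n d ?P q) \<longrightarrow> g \<in> fiber n d I q)"
    by (rule fiber_injective[OF PI assms(1) t _ assms(5) noeth(1) assms(7) I]) (fact alg, fact I2)
  then obtain h1 where h1: "h1 \<in> polys_in {..<d}" "h1 \<noteq> 0"
    "\<forall>q g. eval q h1 \<noteq> 0 \<longrightarrow> g \<in> polys n \<longrightarrow>
      (\<forall>D\<in>N. apply_weyl D g \<in> fiber n d ?P q) \<longrightarrow> g \<in> fiber n d I q"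
    by (elim bexE conjE)
  from fiber_coordinates[OF assms(3) IP P assms(1) t]
  obtain h2 where h2: "h2 \<in> polys_in {..<d}" "h2 \<noteq> 0"
    "\<forall>q j. eval q h2 \<noteq> 0 \<longrightarrow> j < n \<longrightarrow>
      (\<exists>S. finite S \<and> (\<Prod>c\<in>S. Var j - Const c) \<in> fiber n d ?P q)"
    by (elim bexE conjE)
  \<comment> \<open>Outside this set both the injectivity on the fibre, governed by
    \<open>h1\<close>, and the simple coordinate equations, governed by \<open>h2\<close>, are
    available. Both polynomials involve only \<open>t\<close>, so the set lies in the parameter
    space.\<close>
  define Z where "Z = variety d {h1 * h2}"
  have h: "h1 * h2 \<in> polys_in {..<d}" "h1 * h2 \<noteq> 0" using h1 h2 by auto
  obtain y where "eval y (h1 * h2) \<noteq> 0" "\<forall>i. i \<notin> {..<d} \<longrightarrow> y i = 0"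
    using ex_nonvanishing_point[OF _ h] by auto
  then have "y \<in> points d" "y \<notin> Z" by (auto simp: points_def Z_def variety_def)
  moreover have "zariski_closed d Z"
    unfolding zariski_closed_def Z_def using h(1) by (intro exI[of _ "{h1 * h2}"]) (simp add: polys_eq)
  moreover have "cspan (specialize q ` N) =
      punctual_ops n q (ideal_gen n (I \<union> {Var i - Const (q i) | i. i < d}))"
    if q: "q \<in> variety n I" "t_part d q \<notin> Z" for q
  proof
    let ?K = "ideal_gen n (I \<union> {Var i - Const (q i) | i. i < d})"
    show "cspan (specialize q ` N) \<subseteq> punctual_ops n q ?K"
    proof (rule cspan_subset_punctual_ops, rule image_subsetI)
      fix D assume D: "D \<in> N"
      have "apply_weyl D f \<in> ?P" if "f \<in> I" for f
        using noeth(2)[OF ideal_subset[OF I that]] that D by blast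
      then have "pairing q (specialize q D) f = 0" if "f \<in> ?K" for f
        using specialize_kills_ideal_gen[OF I assms(1) q(1) _ _ _ that] noeth(1) assms(7) D by blast
      moreover have "specialize q D \<in> const_ops n" using noeth(1) D by (intro specialize_const_ops) auto
      ultimately show "specialize q D \<in> punctual_ops n q ?K"
        by (simp add: punctual_ops_def eval_apply_const)
    qed
    show "punctual_ops n q ?K \<subseteq> cspan (specialize q ` N)"
    proof
      fix D assume D: "D \<in> punctual_ops n q ?K"
      have "eval (t_part d q) (h1 * h2) \<noteq> 0"
        using q(2) by (auto simp: Z_def variety_def points_def t_part_def)
      moreover have "eval (t_part d q) (h1 * h2) = eval q (h1 * h2)"
        by (rule eval_cong[OF h(1)]) (simp add: t_part_def)
      ultimately have hq: "eval q h1 \<noteq> 0" "eval q h2 \<noteq> 0" by auto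
      let ?J = "fiber n d ?P q"
      have J: "is_ideal n ?J" by (rule fiber_ideal[OF PI assms(1)])
      \<comment> \<open>\<open>L\<close> is to exceed the orders of \<open>D\<close> and of all
        operators in \<open>N\<close>. Specialization introduces no new derivatives, so one
        \<open>L\<close> serves at every point of the fibre.\<close>
      define M where "M = mdeg ` (Poly_Mapping.keys D \<union> (\<Union>E\<in>N. Poly_Mapping.keys E))"
      have "finite M" using assms(5) by (simp add: M_def)
      then obtain L where L': "\<forall>m\<in>M. m < L" unfolding finite_nat_set_iff_bounded ..
      have L: "m < L" if "m \<in> M" for m using L' that by blast
      have "?J \<subseteq> polys n" "q \<in> points n"
        using ideal_subset[OF J] q(1) by (auto simp: variety_def)
      then obtain e where e: "e \<in> polys n" "\<And>f. e * f - f \<in> vanish q L"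
        "\<And>q' f. q' \<in> variety n ?J \<Longrightarrow> q' \<noteq> q \<Longrightarrow> e * f \<in> vanish q' L"
        using ex_localizer[of ?J n q L] h2(3)[rule_format, OF hq(2)] by blast
      have low: "pairing q E (e * f) = pairing q E f" if "\<And>\<alpha>. \<alpha> \<in> Poly_Mapping.keys E \<Longrightarrow> mdeg \<alpha> < L" for E f
        using pairing_vanish[OF e(2)[of f] that] by (simp add: pairing_diff_right)
      show "D \<in> cspan (specialize q ` N)"
      proof (rule const_ops_cspan[where q = q and n = n])
        show "finite (specialize q ` N)" using assms(5) by simp
        show "specialize q ` N \<subseteq> const_ops n" using noeth(1) specialize_const_ops by blast
        show "D \<in> const_ops n" using D by (simp add: punctual_ops_def)
        fix f :: "'k mpoly"
        assume f: "f \<in> polys n" "\<And>E. E \<in> specialize q ` N \<Longrightarrow> pairing q E f = 0"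
        have ef: "e * f \<in> polys n" using e f by (simp add: polys_eq)
        \<comment> \<open>At \<open>q\<close> the localizer does not change the value, which is 0 by
          assumption on \<open>f\<close>; at the other points of the fibre \<open>e * f\<close>
          vanishes to order \<open>L\<close>.\<close>
        have "apply_weyl E (e * f) \<in> ?J" if E: "E \<in> N" for E
        proof (rule mem_if_vanishes_on_variety[OF J h2(3)[rule_format, OF hq(2)]])
          show "apply_weyl E (e * f) \<in> polys n" using apply_weyl_closed ef noeth(1) E by blast
          fix q' assume q': "q' \<in> variety n ?J"
          have deg: "mdeg \<alpha> < L" if "\<alpha> \<in> Poly_Mapping.keys (specialize q' E)" for \<alpha> q'
            using L[of "mdeg \<alpha>"] that keys_specialize[of q' E] E by (auto simp: M_def)
          have "pairing q' (specialize q' E) (e * f) = 0"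
          proof (cases "q' = q")
            case True
            then show ?thesis using low[OF deg] f(2) E by simp
          next
            case False
            show ?thesis by (rule pairing_vanish[OF e(3)[OF q' False]]) (rule deg)
          qed
          then show "eval q' (apply_weyl E (e * f)) = 0" by (simp add: eval_apply_weyl)
        qed
        then have "e * f \<in> fiber n d I q" using h1(3)[rule_format, OF hq(1) ef] by blast
        then have "e * f \<in> ?K" using fiber_subset_ideal_gen by blast
        then have "pairing q D (e * f) = 0" using D by (auto simp: punctual_ops_def eval_apply_const)
        moreover have "mdeg \<alpha> < L" if "\<alpha> \<in> Poly_Mapping.keys D" for \<alpha>
          using L[of "mdeg \<alpha>"] that by (auto simp: M_def)
        ultimately show "pairing q D f = 0" using low by simp
      qed
    qed
  qed
  ultimately show ?thesis by blast
qed

end
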